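(* Let $G$ be a graph and $\theta$ a real number with $\mathrm{mult}(\theta,G)\ge2$. Let $H_1,\dots,H_q$ be the components of $G\setminus A_\theta(G)$ that are $\theta$-critical and $Q_1,\dots,Q_m$ those with $\mathrm{mult}(\theta,Q_j)=0$. For distinct vertices $u,v$, $\mathrm{mult}(\theta,S_\theta(G)\setminus\{u,v\})=\mathrm{mult}(\theta,S_\theta(G))$ if and only if one of the following holds: (a) one of $u,v$ lies in $P_\theta(G)\cup A_\theta(G)$ and the other in $B_\theta(G)$; (b) $u,v\in N_\theta(G)$ with $u\in V(Q_{j_1})$, $v\in V(Q_{j_2})$ for some $j_1\neq j_2$; (c) $u,v\in V(H_{i_0})$ for some $i_0$ and $\mathrm{mult}(\theta,H_{i_0}\setminus\{u,v\})=1$; (d) $u,v\in V(Q_{j_0})$ for some $j_0$ and $\mathrm{mult}(\theta,Q_{j_0}\setminus\{u,v\})=0$.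
   Context: All graphs are finite and simple. For a graph $G$ on $n$ vertices, let $p(G,r)$ be the number of $r$-matchings of $G$ ($p(G,0)=1$); the matching polynomial is $\mu(G,x)=\sum_{r=0}^{\lfloor n/2\rfloor}(-1)^r p(G,r)x^{n-2r}$. For real $\theta$, $\mathrm{mult}(\theta,G)$ is the multiplicity of $\theta$ as a root of $\mu(G,x)$ (it is $0$ if $\theta$ is not a root). $G\setminus X$ denotes deletion of the vertex set $X$; $G\setminus u=G\setminus\{u\}$. A vertex $u$ is $\theta$-essential, $\theta$-neutral, or $\theta$-positive in $G$ according as $\mathrm{mult}(\theta,G\setminus u)$ equals $\mathrm{mult}(\theta,G)-1$, $\mathrm{mult}(\theta,G)$, or $\mathrm{mult}(\theta,G)+1$. A vertex is $\theta$-special if it is not $\theta$-essential but is adjacent to a $\theta$-essential vertex. $B_\theta(G)$, $A_\theta(G)$, $N_\theta(G)$ are the sets of $\theta$-essential, $\theta$-special, $\theta$-neutral vertices, and $P_\theta(G)$ the set of $\theta$-positive vertices that are not $\theta$-special. A connected graph is $\theta$-critical if all its vertices are $\theta$-essential in it; every component of $G\setminus A_\theta(G)$ is either $\theta$-critical or has $\mathrm{mult}(\theta,\cdot)=0$. $S_\theta(G)$ is the graph on $V(G)$ whose edges are the edges of $G$ together with all pairs $\{w,z\}$, $z\neq w$, with $w\in A_\theta(G)$. *)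

theory Defs
  imports Main "HOL-Computational_Algebra.Polynomial"
begin

text \<open>A finite simple graph is given by a vertex set V and a set E of 2-element
subsets of V (the edges).\<close>

definition graph :: "'a set \<Rightarrow> 'a set set \<Rightarrow> bool" where
  "graph V E \<longleftrightarrow> finite V \<and> (\<forall>e\<in>E. e \<subseteq> V \<and> card e = 2)"

text \<open>Number of r-matchings: sets of r pairwise disjoint edges.\<close>
definition nmatch :: "'a set set \<Rightarrow> nat \<Rightarrow> nat" where
  "nmatch E r = card {M. M \<subseteq> E \<and> card M = r \<and> pairwise disjnt M}"

text \<open>Matching polynomial mu(G,x) = sum_r (-1)^r p(G,r) x^(n-2r).\<close>
definition match_poly :: "'a set \<Rightarrow> 'a set set \<Rightarrow> real poly" where
  "match_poly V E = (\<Sum>r\<le>card V div 2. monom ((-1)^r * real (nmatch E r)) (card V - 2*r))"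

text \<open>Multiplicity of theta as a root of the matching polynomial.\<close>
definition mult :: "real \<Rightarrow> 'a set \<Rightarrow> 'a set set \<Rightarrow> nat" where
  "mult \<theta> V E = order \<theta> (match_poly V E)"

text \<open>Induced subgraph on a vertex set W, and vertex deletion G \ X.\<close>
definition induced_edges :: "'a set set \<Rightarrow> 'a set \<Rightarrow> 'a set set" where
  "induced_edges E W = {e\<in>E. e \<subseteq> W}"

definition del_mult :: "real \<Rightarrow> 'a set \<Rightarrow> 'a set set \<Rightarrow> 'a set \<Rightarrow> nat" where
  "del_mult \<theta> V E X = mult \<theta> (V - X) (induced_edges E (V - X))"

definition essential :: "real \<Rightarrow> 'a set \<Rightarrow> 'a set set \<Rightarrow> 'a \<Rightarrow> bool" where
  "essential \<theta> V E u \<longleftrightarrow> int (del_mult \<theta> V E {u}) = int (mult \<theta> V E) - 1"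

definition neutral :: "real \<Rightarrow> 'a set \<Rightarrow> 'a set set \<Rightarrow> 'a \<Rightarrow> bool" where
  "neutral \<theta> V E u \<longleftrightarrow> del_mult \<theta> V E {u} = mult \<theta> V E"

definition positive :: "real \<Rightarrow> 'a set \<Rightarrow> 'a set set \<Rightarrow> 'a \<Rightarrow> bool" where
  "positive \<theta> V E u \<longleftrightarrow> del_mult \<theta> V E {u} = mult \<theta> V E + 1"

definition special :: "real \<Rightarrow> 'a set \<Rightarrow> 'a set set \<Rightarrow> 'a \<Rightarrow> bool" where
  "special \<theta> V E u \<longleftrightarrow> \<not> essential \<theta> V E u \<and>
     (\<exists>w\<in>V. {u, w} \<in> E \<and> essential \<theta> V E w)"

definition Bset :: "real \<Rightarrow> 'a set \<Rightarrow> 'a set set \<Rightarrow> 'a set" where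
  "Bset \<theta> V E = {u\<in>V. essential \<theta> V E u}"

definition Aset :: "real \<Rightarrow> 'a set \<Rightarrow> 'a set set \<Rightarrow> 'a set" where
  "Aset \<theta> V E = {u\<in>V. special \<theta> V E u}"

definition Nset :: "real \<Rightarrow> 'a set \<Rightarrow> 'a set set \<Rightarrow> 'a set" where
  "Nset \<theta> V E = {u\<in>V. neutral \<theta> V E u}"

definition Pset :: "real \<Rightarrow> 'a set \<Rightarrow> 'a set set \<Rightarrow> 'a set" where
  "Pset \<theta> V E = {u\<in>V. positive \<theta> V E u \<and> \<not> special \<theta> V E u}"

text \<open>Connected components (as vertex sets) of the graph (V, E).\<close>
definition adj_rel :: "'a set \<Rightarrow> 'a set set \<Rightarrow> ('a \<times> 'a) set" where
  "adj_rel V E = {(x, y). x \<in> V \<and> y \<in> V \<and> {x, y} \<in> E}"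

definition components :: "'a set \<Rightarrow> 'a set set \<Rightarrow> 'a set set" where
  "components V E = {(adj_rel V E)\<^sup>* `` {v} | v. v \<in> V}"

definition connected_graph :: "'a set \<Rightarrow> 'a set set \<Rightarrow> bool" where
  "connected_graph V E \<longleftrightarrow> V \<noteq> {} \<and> (\<forall>x\<in>V. \<forall>y\<in>V. (x, y) \<in> (adj_rel V E)\<^sup>*)"

definition critical :: "real \<Rightarrow> 'a set \<Rightarrow> 'a set set \<Rightarrow> bool" where
  "critical \<theta> V E \<longleftrightarrow> connected_graph V E \<and> (\<forall>u\<in>V. essential \<theta> V E u)"

text \<open>Components of G \ A_theta(G), split into theta-critical ones (H_i) and
those with mult = 0 (Q_j). Each component C carries the induced graph.\<close>
definition Hcomps :: "real \<Rightarrow> 'a set \<Rightarrow> 'a set set \<Rightarrow> 'a set set" where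
  "Hcomps \<theta> V E = {C \<in> components (V - Aset \<theta> V E) (induced_edges E (V - Aset \<theta> V E)).
                     critical \<theta> C (induced_edges E C)}"

definition Qcomps :: "real \<Rightarrow> 'a set \<Rightarrow> 'a set set \<Rightarrow> 'a set set" where
  "Qcomps \<theta> V E = {C \<in> components (V - Aset \<theta> V E) (induced_edges E (V - Aset \<theta> V E)).
                     mult \<theta> C (induced_edges E C) = 0}"

text \<open>Edge set of S_theta(G).\<close>
definition S_edges :: "real \<Rightarrow> 'a set \<Rightarrow> 'a set set \<Rightarrow> 'a set set" where
  "S_edges \<theta> V E = E \<union> {{w, z} | w z. w \<in> Aset \<theta> V E \<and> z \<in> V \<and> z \<noteq> w}"

end

theory Submission
  imports Defs
begin

text \<open>
  For real vertex weights \<open>y\<close> the matching polynomial \<open>f\<close> satisfies the Rayleigh inequality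
  \<open>f\<^sup>u f\<^sup>v - f f\<^sup>u\<^sup>v \<ge> 0\<close> (superscripts denote vertex deletion), with the stronger lower bound
  \<open>(f\<^sup>u\<^sup>v)\<^sup>2\<close> when \<open>uv\<close> is an edge. As a polynomial in the variable \<open>x\<close>, its left-hand side vanishes at
  \<open>\<theta>\<close> to even order; together with \<open>f' = \<Sum> f\<^sup>v\<close> this yields interlacing and the positivity of special
  vertices. Perturbing the weight of a third vertex linearly in \<open>\<sigma>\<close> must preserve nonnegativity for
  all \<open>\<sigma>\<close>, which rules out the configurations violating Gallai's lemma and the stability of vertex
  types under deletion of a special vertex.

  Hence deleting \<open>A = A\<^sub>\<theta>(G)\<close> raises the multiplicity by \<open>|A|\<close>. In \<open>S\<^sub>\<theta>(G)\<close> the vertices of \<open>A\<close> are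
  joined to everything, and adding such a vertex turns \<open>f\<close> into \<open>x f - f'\<close>, lowering a positive
  multiplicity by exactly one. So multiplicities in \<open>S\<^sub>\<theta>(G)\<close> are those of \<open>G \<setminus> A\<close> minus the number
  of remaining vertices of \<open>A\<close>; here multiplicity at least two guarantees that they stay positive while
  the vertices of \<open>A\<close> are put back.
\<close>

section \<open>The weighted matching polynomial\<close>

definition matchings :: "'a set set \<Rightarrow> 'a set \<Rightarrow> 'a set set set" where
  "matchings E W = {M. M \<subseteq> induced_edges E W \<and> pairwise disjnt M}"

text \<open>The ring of weights is left open: real weights serve for the Rayleigh inequality,
  polynomial weights for multiplicities. \<open>E\<close> stays fixed, so deleting vertices only
  shrinks \<open>W\<close>.\<close>

definition wmatch :: "'a set set \<Rightarrow> ('a \<Rightarrow> 'b::comm_ring_1) \<Rightarrow> 'a set \<Rightarrow> 'b" where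
  "wmatch E x W = (\<Sum>M\<in>matchings E W. (-1) ^ card M * (\<Prod>v\<in>W - \<Union>M. x v))"

lemma wmatch_cong:
  assumes "induced_edges E W = induced_edges E' W" and "\<And>v. v \<in> W \<Longrightarrow> x v = y v"
  shows "wmatch E x W = wmatch E' y W"
proof -
  have "matchings E W = matchings E' W"
    using assms(1) by (simp add: matchings_def)
  then show ?thesis
    unfolding wmatch_def using assms(2) by (auto intro!: sum.cong prod.cong)
qed

lemma finite_matchings: "finite W \<Longrightarrow> finite (matchings E W)"
  by (rule finite_subset[of _ "Pow (Pow W)"]) (auto simp: matchings_def induced_edges_def)

lemma wmatch_hom:
  fixes h :: "'b::comm_ring_1 \<Rightarrow> 'c::comm_ring_1"
  assumes "\<And>a b. h (a + b) = h a + h b" "\<And>a b. h (a * b) = h a * h b" "h 1 = 1" "h 0 = 0"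
  shows "h (wmatch E x W) = wmatch E (\<lambda>v. h (x v)) W"
proof -
  have neg: "h (- 1) = - 1"
    using assms(1)[of 1 "-1"] assms(3,4) by (simp add: eq_neg_iff_add_eq_0 add.commute)
  have pow: "h (a ^ n) = h a ^ n" for a n
    by (induction n) (simp_all add: assms)
  have prod: "h (prod f A) = (\<Prod>a\<in>A. h (f a))" for f :: "'a \<Rightarrow> 'b" and A
    by (induction A rule: infinite_finite_induct) (simp_all add: assms)
  have sum: "h (sum f A) = (\<Sum>a\<in>A. h (f a))" for f :: "'a set set \<Rightarrow> 'b" and A
    by (induction A rule: infinite_finite_induct) (simp_all add: assms)
  show ?thesis
    by (simp add: wmatch_def sum prod pow neg assms)
qed

lemma poly_wmatch: "poly (wmatch E x W) z = wmatch E (\<lambda>v. poly (x v) z) W"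
  by (rule wmatch_hom) simp_all

text \<open>A matching misses \<open>u\<close> or contains exactly one edge \<open>{u, w}\<close>;
  removing that edge leaves a matching of \<open>W - {u, w}\<close> and flips the sign.\<close>

lemma wmatch_rec:
  fixes x :: "'a \<Rightarrow> 'b::comm_ring_1"
  assumes fin: "finite W" and u: "u \<in> W" and card2: "\<And>e. e \<in> E \<Longrightarrow> card e = 2"
  shows "wmatch E x W =
    x u * wmatch E x (W - {u}) - (\<Sum>w\<in>{w \<in> W - {u}. {u, w} \<in> E}. wmatch E x (W - {u, w}))"
proof -
  define t where "t U M = (-1) ^ card M * (\<Prod>v\<in>U - \<Union>M. x v)" for U M
  define N where "N = {w \<in> W - {u}. {u, w} \<in> E}"
  define S where "S = Sigma N (\<lambda>w. matchings E (W - {u, w}))"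
  have finM: "finite (matchings E W)"
    by (rule finite_matchings[OF fin])
  have avoid: "{M \<in> matchings E W. u \<notin> \<Union>M} = matchings E (W - {u})"
    by (auto simp: matchings_def induced_edges_def)
  have sum1: "(\<Sum>M\<in>matchings E (W - {u}). t W M) = x u * wmatch E x (W - {u})"
    unfolding wmatch_def sum_distrib_left
  proof (rule sum.cong)
    fix M assume "M \<in> matchings E (W - {u})"
    then have "W - \<Union>M = insert u (W - {u} - \<Union>M)"
      using u by (auto simp: matchings_def induced_edges_def)
    then show "t W M = x u * ((-1) ^ card M * (\<Prod>v\<in>W - {u} - \<Union>M. x v))"
      using fin by (simp add: t_def mult_ac)
  qed simp
  have bij: "bij_betw (\<lambda>(w, M). insert {u, w} M) S {M \<in> matchings E W. u \<in> \<Union>M}"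
  proof (rule bij_betwI')
    fix p q assume p: "p \<in> S" and q: "q \<in> S"
    obtain w M w' M' where pq: "p = (w, M)" "q = (w', M')" by fastforce
    show "((case p of (w, M) \<Rightarrow> insert {u, w} M) = (case q of (w, M) \<Rightarrow> insert {u, w} M)) = (p = q)"
    proof
      assume "(case p of (w, M) \<Rightarrow> insert {u, w} M) = (case q of (w, M) \<Rightarrow> insert {u, w} M)"
      then have eq: "insert {u, w} M = insert {u, w'} M'" by (simp add: pq)
      have un: "u \<notin> \<Union>M" "u \<notin> \<Union>M'"
        using p q by (auto simp: pq S_def matchings_def induced_edges_def)
      have "{u, w} = {u, w'}" using eq un(2) by (metis UnionI insertE insertI1)
      then have ww: "w = w'" by (auto simp: doubleton_eq_iff)
      have "M = M'"
        using eq un unfolding ww by (metis UnionI insertI1 insert_ident)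
      with ww show "p = q" by (simp add: pq)
    qed simp
  next
    fix p assume p: "p \<in> S"
    obtain w M where pq: "p = (w, M)" by fastforce
    have "disjnt {u, w} e" if "e \<in> M" for e
      using p that by (auto simp: pq S_def matchings_def induced_edges_def disjnt_def)
    then show "(case p of (w, M) \<Rightarrow> insert {u, w} M) \<in> {M \<in> matchings E W. u \<in> \<Union>M}"
      using p u by (auto simp: pq S_def N_def matchings_def induced_edges_def pairwise_insert disjnt_sym)
  next
    fix M assume M: "M \<in> {M \<in> matchings E W. u \<in> \<Union>M}"
    then obtain e where e: "e \<in> M" "u \<in> e" by auto
    have eE: "e \<in> E" "e \<subseteq> W" using e M by (auto simp: matchings_def induced_edges_def)
    obtain w where w: "e = {u, w}" "w \<noteq> u"
      using card2[OF eE(1)] e(2) by (metis card_2_iff insert_commute insert_iff singletonD)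
    have "disjnt e e'" if "e' \<in> M - {e}" for e'
      using M that e(1) by (auto simp: matchings_def pairwise_def)
    then have "M - {e} \<in> matchings E (W - {u, w})"
      using M unfolding w by (fastforce simp: matchings_def induced_edges_def disjnt_def pairwise_def)
    then have "(w, M - {e}) \<in> S"
      using w eE by (auto simp: S_def N_def)
    moreover have "M = (case (w, M - {e}) of (w, M) \<Rightarrow> insert {u, w} M)"
      using e(1) w(1) by auto
    ultimately show "\<exists>p\<in>S. M = (case p of (w, M) \<Rightarrow> insert {u, w} M)" by blast
  qed
  have "(\<Sum>M\<in>{M \<in> matchings E W. u \<in> \<Union>M}. t W M) = (\<Sum>(w, M)\<in>S. t W (insert {u, w} M))"
    using sum.reindex_bij_betw[OF bij, of "t W"] by (simp add: case_prod_unfold)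
  also have "\<dots> = (\<Sum>(w, M)\<in>S. - t (W - {u, w}) M)"
  proof (rule sum.cong)
    fix p assume p: "p \<in> S"
    obtain w M where pq: "p = (w, M)" by fastforce
    have M: "M \<in> matchings E (W - {u, w})" using p by (simp add: pq S_def)
    have finM: "finite M"
      using M fin by (auto simp: matchings_def induced_edges_def intro: finite_subset[of _ "Pow W"])
    have "{u, w} \<notin> M" using M by (auto simp: matchings_def induced_edges_def)
    moreover have "W - \<Union>(insert {u, w} M) = W - {u, w} - \<Union>M" by auto
    ultimately have "t W (insert {u, w} M) = - t (W - {u, w}) M"
      using finM by (simp add: t_def)
    then show "(case p of (w, M) \<Rightarrow> t W (insert {u, w} M)) = (case p of (w, M) \<Rightarrow> - t (W - {u, w}) M)"
      by (simp add: pq)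
  qed simp
  also have "\<dots> = (\<Sum>w\<in>N. \<Sum>M\<in>matchings E (W - {u, w}). - t (W - {u, w}) M)"
    unfolding S_def by (rule sum.Sigma[symmetric]) (use fin in \<open>auto simp: N_def intro!: finite_matchings\<close>)
  also have "\<dots> = - (\<Sum>w\<in>N. wmatch E x (W - {u, w}))"
    by (simp add: sum_negf wmatch_def t_def)
  finally have sum2: "(\<Sum>M\<in>{M \<in> matchings E W. u \<in> \<Union>M}. t W M) = - (\<Sum>w\<in>N. wmatch E x (W - {u, w}))" .
  have "wmatch E x W = (\<Sum>M\<in>{M \<in> matchings E W. u \<notin> \<Union>M} \<union> {M \<in> matchings E W. u \<in> \<Union>M}. t W M)"
    unfolding wmatch_def t_def by (rule sum.cong) auto
  also have "\<dots> = (\<Sum>M\<in>{M \<in> matchings E W. u \<notin> \<Union>M}. t W M) + (\<Sum>M\<in>{M \<in> matchings E W. u \<in> \<Union>M}. t W M)"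
    by (rule sum.union_disjoint) (use finM in auto)
  finally show ?thesis
    unfolding avoid sum1 sum2 by (simp add: N_def)
qed

text \<open>An \<open>r\<close>-matching covers exactly \<open>2 * r\<close> vertices, which fixes
  the exponent; then matchings are grouped by size.\<close>

lemma match_poly_wmatch:
  assumes fin: "finite W" and card2: "\<And>e. e \<in> E \<Longrightarrow> card e = 2"
  shows "match_poly W (induced_edges E W) = wmatch E (\<lambda>_. [:0, 1:]) W"
proof -
  have M2: "2 * card M \<le> card W" "card (W - \<Union>M) = card W - 2 * card M" if "M \<in> matchings E W" for M
  proof -
    have sub: "M \<subseteq> Pow W" and c2: "\<And>e. e \<in> M \<Longrightarrow> card e = 2" and pw: "pairwise disjnt M"
      using that card2 by (auto simp: matchings_def induced_edges_def)
    have "card (\<Union>M) = (\<Sum>e\<in>M. card e)"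
      by (rule card_Union_disjoint) (use pw sub fin in \<open>auto intro: finite_subset\<close>)
    also have "\<dots> = 2 * card M" using c2 by simp
    finally have U: "card (\<Union>M) = 2 * card M" .
    have sU: "\<Union>M \<subseteq> W" using sub by auto
    show "2 * card M \<le> card W" using card_mono[OF fin sU] U by simp
    show "card (W - \<Union>M) = card W - 2 * card M"
      using card_Diff_subset[OF finite_subset[OF sU fin] sU] U by simp
  qed
  have "wmatch E (\<lambda>_. [:0, 1:] :: real poly) W
      = (\<Sum>M\<in>matchings E W. monom ((-1) ^ card M) (card W - 2 * card M))"
    unfolding wmatch_def by (rule sum.cong) (auto simp: M2 monom_altdef minus_one_power_iff)
  also have "\<dots> = (\<Sum>r\<le>card W div 2. \<Sum>M\<in>{M \<in> matchings E W. card M = r}.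
      monom ((-1) ^ card M) (card W - 2 * card M))"
    by (rule sum.group[symmetric]) (use M2(1) finite_matchings[OF fin] in \<open>auto simp: less_eq_div_iff_mult_less_eq mult.commute\<close>)
  also have "\<dots> = match_poly W (induced_edges E W)"
    unfolding match_poly_def
  proof (rule sum.cong)
    fix r
    have "{M \<in> matchings E W. card M = r} = {M. M \<subseteq> induced_edges E W \<and> card M = r \<and> pairwise disjnt M}"
      by (auto simp: matchings_def)
    then show "(\<Sum>M\<in>{M \<in> matchings E W. card M = r}. monom ((-1) ^ card M) (card W - 2 * card M))
        = monom ((-1) ^ r * real (nmatch (induced_edges E W) r)) (card W - 2 * r)"
      by (simp add: nmatch_def of_nat_poly smult_monom mult.commute)
  qed simp
  finally show ?thesis ..
qed

section \<open>Orders of vanishing of real polynomials\<close>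

lemma coeff_less_order:
  assumes "i < order 0 p"
  shows "coeff p i = 0"
proof (cases "p = 0")
  case False
  then show ?thesis
    using assms monom_1_dvd_iff[of p "order 0 p"] by (simp add: monom_1_dvd_iff')
qed simp

lemma coeff_order_nz:
  assumes "p \<noteq> 0"
  shows "coeff p (order 0 p) \<noteq> 0"
proof
  assume "coeff p (order 0 p) = 0"
  then have "monom 1 (Suc (order 0 p)) dvd p"
    by (auto simp: monom_1_dvd_iff' less_Suc_eq coeff_less_order)
  then show False using monom_1_dvd_iff[OF assms] by simp
qed

lemma order_0_eqI:
  assumes "\<And>i. i < n \<Longrightarrow> coeff p i = 0" and "coeff p n \<noteq> 0"
  shows "order 0 p = n"
proof -
  have p: "p \<noteq> 0" using assms(2) by auto
  show ?thesis
    using assms coeff_less_order[of _ p] coeff_order_nz[OF p] by (metis linorder_neqE_nat)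
qed

text \<open>The shift turns \<open>(x - a)^k q\<close> with \<open>q(a)\<close> nonzero into
  \<open>x^k\<close> times a polynomial with nonzero constant term.\<close>

lemma order_pcompose_shift:
  fixes p :: "real poly"
  assumes "p \<noteq> 0"
  shows "order 0 (pcompose p [:a, 1:]) = order a p"
proof -
  obtain q where p: "p = [:- a, 1:] ^ order a p * q" and q: "\<not> [:- a, 1:] dvd q"
    using order_decomp[OF assms] by blast
  have pw: "pcompose (r ^ n) s = pcompose r s ^ n" for r s :: "real poly" and n
    by (induction n) (simp_all add: pcompose_1 pcompose_mult)
  have "pcompose p [:a, 1:] = monom 1 (order a p) * pcompose q [:a, 1:]"
    by (subst p) (simp add: pcompose_mult pw pcompose_pCons monom_altdef)
  moreover have "coeff (pcompose q [:a, 1:]) 0 \<noteq> 0"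
    using q by (simp add: poly_pcompose poly_eq_0_iff_dvd flip: poly_0_coeff_0)
  ultimately show ?thesis
    by (intro order_0_eqI) (simp_all add: coeff_monom_mult)
qed

text \<open>One-sided limits at \<open>0\<close>: to the right \<open>z ^ n\<close> is positive, to
  the left it is negative for odd \<open>n\<close>, which forces both signs on
  \<open>q\<close>.\<close>

lemma nonneg_monom_mult:
  fixes q :: "real poly"
  assumes "\<And>z. 0 \<le> poly (monom 1 n * q) z"
  shows "0 \<le> poly q 0" and "odd n \<Longrightarrow> poly q 0 = 0"
proof -
  have R: "((poly q) \<longlongrightarrow> poly q 0) (at_right 0)" and L: "((poly q) \<longlongrightarrow> poly q 0) (at_left 0)"
    using poly_isCont[of 0 q] by (auto simp: isCont_def intro: filterlim_mono at_le)
  have le: "0 \<le> z ^ n * poly q z" for z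
    using assms[of z] by (simp add: poly_monom)
  have "\<forall>\<^sub>F z in at_right (0::real). 0 \<le> poly q z"
    using eventually_at_right_less[of "0::real"]
    by eventually_elim (use le in \<open>metis zero_le_mult_iff zero_less_power not_less\<close>)
  then show 1: "0 \<le> poly q 0"
    by (intro tendsto_lowerbound[OF R]) auto
  assume n: "odd n"
  have "\<forall>\<^sub>F z in at_left (0::real). z < 0"
    by (simp add: eventually_at_filter)
  then have "\<forall>\<^sub>F z in at_left (0::real). poly q z \<le> 0"
  proof eventually_elim
    case (elim z)
    then have "z ^ n < 0" using n by simp
    then show ?case using le[of z] by (metis zero_le_mult_iff not_less)
  qed
  then have "poly q 0 \<le> 0"
    by (intro tendsto_upperbound[OF L]) auto
  with 1 show "poly q 0 = 0" by simp
qed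

lemma nonneg_coeff:
  fixes p :: "real poly"
  assumes "\<And>z. 0 \<le> poly p z" and "\<And>i. i < n \<Longrightarrow> coeff p i = 0"
  shows "0 \<le> coeff p n" and "odd n \<Longrightarrow> coeff p n = 0"
proof -
  have "monom 1 n dvd p" using assms(2) by (simp add: monom_1_dvd_iff')
  then obtain q where p: "p = monom 1 n * q" by auto
  have c: "coeff p n = poly q 0" by (simp add: p coeff_monom_mult poly_0_coeff_0)
  show "0 \<le> coeff p n" "odd n \<Longrightarrow> coeff p n = 0"
    unfolding c by (use nonneg_monom_mult[of n q] assms(1) p in auto)
qed

lemma order_nonneg_even:
  fixes p :: "real poly"
  assumes "p \<noteq> 0" "\<And>z. 0 \<le> poly p z"
  shows "even (order 0 p)"
  using nonneg_coeff(2)[of p "order 0 p"] coeff_order_nz[of p] coeff_less_order[of _ p] assms by blast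

lemma order_diff_less:
  assumes "p \<noteq> 0" "order 0 p < order 0 q"
  shows "order 0 (p - q) = order 0 p" and "p - q \<noteq> 0"
proof -
  show "order 0 (p - q) = order 0 p"
    by (rule order_0_eqI) (use assms coeff_order_nz in \<open>auto simp: coeff_less_order\<close>)
  show "p - q \<noteq> 0" using assms by auto
qed

text \<open>For larger \<open>n\<close> the lowest coefficient of the nonnegative
  \<open>p - q * q\<close> would be minus a nonzero square.\<close>

lemma order_of_square_le:
  fixes p q :: "real poly"
  assumes "\<And>z. (poly q z)\<^sup>2 \<le> poly p z" and "monom 1 n dvd p" and "q \<noteq> 0"
  shows "n \<le> 2 * order 0 q"
proof (rule ccontr)
  let ?m = "order 0 q"
  assume "\<not> n \<le> 2 * ?m"
  then have n: "2 * ?m < n" by simp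
  obtain r where q: "q = monom 1 ?m * r"
    using monom_1_dvd_iff[OF assms(3)] by blast
  have r: "coeff r 0 \<noteq> 0"
    using coeff_order_nz[OF assms(3)] by (subst (asm) q) (simp add: coeff_monom_mult)
  have q2: "q * q = monom 1 (2 * ?m) * (r * r)"
    by (subst (1 2) q) (simp add: mult_monom mult_2 algebra_simps)
  have z: "coeff p i = 0" if "i < n" for i
    using assms(2) that by (simp add: monom_1_dvd_iff')
  have "0 \<le> coeff (p - q * q) (2 * ?m)"
  proof (rule nonneg_coeff)
    show "0 \<le> poly (p - q * q) x" for x
      using assms(1)[of x] by (simp add: power2_eq_square)
  qed (use z n in \<open>simp add: q2 coeff_monom_mult\<close>)
  then have "(coeff r 0)\<^sup>2 \<le> 0"
    using z n by (simp add: q2 coeff_monom_mult coeff_mult_0 power2_eq_square)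
  then show False using r by simp
qed

lemma monom_dvd_pderiv:
  fixes p :: "real poly"
  assumes "monom 1 n dvd p"
  shows "monom 1 (n - 1) dvd pderiv p"
  using assms by (auto simp: monom_1_dvd_iff' coeff_pderiv)

text \<open>The order conditions kill all terms below degree \<open>m + n\<close> and leave
  \<open>C' * D\<close> as the only source of \<open>\<sigma>\<close> in that degree. The
  coefficient there is affine and nonconstant in \<open>\<sigma>\<close>, so some
  \<open>\<sigma>\<close> makes it negative.\<close>

lemma no_perturbation:
  fixes A A' B B' C C' D D' :: "real poly"
  assumes nn: "\<And>\<sigma> z. 0 \<le> poly ((A + [:0, \<sigma>:] * A') * (B + [:0, \<sigma>:] * B')
                              - (C + [:0, \<sigma>:] * C') * (D + [:0, \<sigma>:] * D')) z"
    and nz: "A \<noteq> 0" "A' \<noteq> 0" "B \<noteq> 0" "B' \<noteq> 0" "C \<noteq> 0" "C' \<noteq> 0" "D \<noteq> 0" "D' \<noteq> 0"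
    and o: "order 0 C' + 1 = m" "m \<le> order 0 C" "order 0 D = n" "n \<le> order 0 D'"
      "m + n \<le> order 0 A + order 0 B" "m + n \<le> order 0 A + order 0 B'"
      "m + n \<le> order 0 A' + order 0 B" "m + n \<le> order 0 A' + order 0 B' + 1"
  shows False
proof -
  let ?N = "m + n"
  define Q0 where "Q0 = A * B - C * D"
  define Q1 where "Q1 = A * B' + A' * B - C * D'"
  define Q2 where "Q2 = A' * B' - C' * D'"
  define P where "P \<sigma> = Q0 + smult \<sigma> (monom 1 1 * (Q1 - C' * D)) + smult (\<sigma>\<^sup>2) (monom 1 2 * Q2)" for \<sigma>
  have t: "[:0, \<sigma>:] = smult \<sigma> (monom 1 1)" for \<sigma> :: real
    by (simp add: monom_altdef)
  have P: "P \<sigma> = (A + [:0, \<sigma>:] * A') * (B + [:0, \<sigma>:] * B')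
                              - (C + [:0, \<sigma>:] * C') * (D + [:0, \<sigma>:] * D')" for \<sigma>
    unfolding P_def Q0_def Q1_def Q2_def t
    by (simp add: algebra_simps smult_add_right smult_diff_right power2_eq_square mult_monom
       flip: numeral_2_eq_2 mult.assoc)
  have c: "coeff (p * q) i = 0" if "i < order 0 p + order 0 q" "p \<noteq> 0" "q \<noteq> 0" for p q :: "real poly" and i
    by (rule coeff_less_order) (use that in \<open>simp add: order_mult\<close>)
  have q0: "coeff Q0 i = 0" if "i < ?N" for i
    using that o nz by (simp add: Q0_def c)
  have q1: "coeff Q1 i = 0" if "i < ?N" for i
    using that o nz by (simp add: Q1_def c)
  have q2: "coeff Q2 i = 0" if "i + 1 < ?N" for i
    using that o nz by (simp add: Q2_def c)
  have cd: "coeff (C' * D) i = 0" if "i + 1 < ?N" for i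
    using that o nz by (simp add: c)
  have N: "?N > 0" using o by simp
  define \<alpha> where "\<alpha> = coeff (C' * D) (?N - 1)"
  have oCD: "order 0 (C' * D) = ?N - 1"
    using o nz by (simp add: order_mult)
  have \<alpha>: "\<alpha> \<noteq> 0"
    using coeff_order_nz[of "C' * D"] nz by (simp add: \<alpha>_def oCD)
  have pos: "0 \<le> coeff (P \<sigma>) ?N" for \<sigma>
  proof (rule nonneg_coeff)
    show "0 \<le> poly (P \<sigma>) z" for z using nn unfolding P .
    fix i assume i: "i < ?N"
    have "coeff Q0 i = 0" "coeff Q1 (i - 1) = 0" "i \<ge> 1 \<Longrightarrow> coeff (C' * D) (i - 1) = 0"
      "i \<ge> 2 \<Longrightarrow> coeff Q2 (i - 2) = 0"
      using i by (auto intro: q0 q1 q2 cd)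
    then show "coeff (P \<sigma>) i = 0"
      by (auto simp: P_def coeff_monom_mult)
  qed
  have "coeff (P \<sigma>) ?N = coeff Q0 ?N - \<sigma> * \<alpha>" for \<sigma>
    using N q1[of "?N - 1"] q2[of "?N - 2"] by (auto simp: P_def coeff_monom_mult \<alpha>_def)
  \<comment> \<open>With this \<open>\<sigma>\<close> the coefficient equals
    \<open>-1\<close>.\<close>
  then have "0 \<le> coeff Q0 ?N - (coeff Q0 ?N + 1) / \<alpha> * \<alpha>"
    using pos by metis
  with \<alpha> show False by simp
qed

section \<open>The Rayleigh inequality\<close>

locale edge_set =
  fixes E :: "'a set set"
  assumes card2: "e \<in> E \<Longrightarrow> card e = 2"
begin

lemma wmatch_empty: "wmatch E x {} = 1"
proof -
  have "matchings E {} = {{}}"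
    using card2 by (fastforce simp: matchings_def induced_edges_def)
  then show ?thesis by (simp add: wmatch_def)
qed

lemma wmatch_rec':
  assumes "finite W" "u \<in> W"
  shows "wmatch E x W = x u * wmatch E x (W - {u})
    - (\<Sum>w\<in>{w \<in> W - {u}. {u, w} \<in> E}. wmatch E x (W - {u, w}))"
  by (rule wmatch_rec) (use assms card2 in auto)

text \<open>In the expansion along \<open>b\<close>, the weight of \<open>b\<close> occurs only in
  the first term, and there linearly.\<close>

lemma wmatch_perturb:
  assumes "finite W" "b \<in> W"
  shows "wmatch E (x(b := x b + s)) W = wmatch E x W + s * wmatch E x (W - {b})"
proof -
  have c: "wmatch E (x(b := x b + s)) (W - insert b U) = wmatch E x (W - insert b U)" for U
    by (rule wmatch_cong) auto
  show ?thesis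
    using c[of "{}"] c by (simp add: wmatch_rec'[OF assms] algebra_simps)
qed

text \<open>Induction on \<open>C\<close>: a vertex of \<open>C\<close> has no neighbours in
  \<open>D\<close>, so expanding both sides along it gives the same recursion.\<close>

lemma wmatch_union:
  assumes "finite C" "finite D" "C \<inter> D = {}"
    and "\<And>u w. u \<in> C \<Longrightarrow> w \<in> D \<Longrightarrow> {u, w} \<notin> E"
  shows "wmatch E x (C \<union> D) = wmatch E x C * wmatch E x D"
  using assms
proof (induction "card C" arbitrary: C rule: less_induct)
  case less
  show ?case
  proof (cases "C = {}")
    case True
    then show ?thesis by (simp add: wmatch_empty)
  next
    case False
    then obtain u where u: "u \<in> C" by auto
    have IH: "wmatch E x (C - X \<union> D) = wmatch E x (C - X) * wmatch E x D" if "u \<in> X" for X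
    proof (rule less.hyps)
      show "card (C - X) < card C"
        using u that less.prems(1) by (intro psubset_card_mono) auto
    qed (use less.prems in auto)
    have eq: "C \<union> D - X = (C - X) \<union> D" if "X \<inter> D = {}" for X
      using that by auto
    have N: "{w \<in> C \<union> D - {u}. {u, w} \<in> E} = {w \<in> C - {u}. {u, w} \<in> E}"
      using u less.prems(4) by auto
    have uD: "u \<notin> D" using u less.prems(3) by auto
    have "wmatch E x (C \<union> D) = x u * wmatch E x (C \<union> D - {u})
        - (\<Sum>w\<in>{w \<in> C - {u}. {u, w} \<in> E}. wmatch E x (C \<union> D - {u, w}))"
      using wmatch_rec'[of "C \<union> D" u x] less.prems u unfolding N by simp
    also have "\<dots> = x u * (wmatch E x (C - {u}) * wmatch E x D)
        - (\<Sum>w\<in>{w \<in> C - {u}. {u, w} \<in> E}. wmatch E x (C - {u, w}) * wmatch E x D)"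
    proof -
      have "wmatch E x (C \<union> D - {u, w}) = wmatch E x (C - {u, w}) * wmatch E x D" if "w \<in> C" for w
        using IH[of "{u, w}"] eq[of "{u, w}"] uD that less.prems(3) by (metis insertI1 disjoint_iff insertE singletonD)
      then show ?thesis
        using IH[of "{u}"] eq[of "{u}"] uD by (intro arg_cong2[of _ _ _ _ "(-)"] sum.cong) auto
    qed
    also have "\<dots> = wmatch E x C * wmatch E x D"
      using wmatch_rec'[of C u x] less.prems u by (simp add: left_diff_distrib sum_distrib_right mult.assoc)
    finally show ?thesis .
  qed
qed

text \<open>Expanding both factors along \<open>u\<close> gives
  \<open>f\<^sup>u f\<^sup>v - f f\<^sup>u\<^sup>v\<close> as a sum of differences of the same kind for the graph without \<open>u\<close>.\<close>
lemma rayleigh: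
  fixes y :: "'a \<Rightarrow> real"
  assumes "finite W" "u \<in> W" "v \<in> W" "u \<noteq> v"
  shows "(if {u, v} \<in> E then (wmatch E y (W - {u, v}))\<^sup>2 else 0)
    \<le> wmatch E y (W - {u}) * wmatch E y (W - {v}) - wmatch E y W * wmatch E y (W - {u, v})"
  using assms
proof (induction "card W" arbitrary: W u v rule: less_induct)
  case less
  let ?f = "\<lambda>X. wmatch E y (W - X)"
  define N where "N = {w \<in> W - {u}. {u, w} \<in> E}"
  have finN: "finite N" using less.prems by (simp add: N_def)
  \<comment> \<open>The Rayleigh difference of \<open>w\<close> and \<open>v\<close> in the graph
    without \<open>u\<close>, nonnegative by induction.\<close>
  define K where "K w = ?f {u, w} * ?f {u, v} - ?f {u} * ?f {u, v, w}" for w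
  have Wv: "W - {v} - {u} = W - {u, v}" "\<And>w. W - {v} - {u, w} = W - {u, v, w}" by auto
  have rec: "wmatch E y W = y u * ?f {u} - (\<Sum>w\<in>N. ?f {u, w})"
    using wmatch_rec'[of W u y] less.prems by (simp add: N_def)
  have N': "{w \<in> W - {v} - {u}. {u, w} \<in> E} = N - {v}"
    by (auto simp: N_def)
  have rec': "?f {v} = y u * ?f {u, v} - (\<Sum>w\<in>N - {v}. ?f {u, v, w})"
    using wmatch_rec'[of "W - {v}" u y, unfolded N', unfolded Wv] less.prems by simp
  have K: "0 \<le> K w" if "w \<in> N - {v}" for w
  proof -
    have eq: "W - {u} - {w} = W - {u, w}" "W - {u} - {v} = W - {u, v}" "W - {u} - {w, v} = W - {u, v, w}"
      by auto
    have "(if {w, v} \<in> E then (wmatch E y (W - {u} - {w, v}))\<^sup>2 else 0) \<le> K w"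
      unfolding K_def eq(1,2)[symmetric] eq(3)[symmetric]
      by (rule less.hyps) (use less.prems that card_Diff1_less[of W u] in \<open>auto simp: N_def\<close>)
    then show ?thesis by (smt (verit) zero_le_power2)
  qed
  \<comment> \<open>If \<open>v\<close> is a neighbour of \<open>u\<close>, it contributes to the
    expansion of \<open>W\<close> but not to that of \<open>W - {v}\<close>; this surplus term
    yields the square.\<close>
  have S: "(\<Sum>w\<in>N. ?f {u, w}) = (\<Sum>w\<in>N - {v}. ?f {u, w}) + (if {u, v} \<in> E then ?f {u, v} else 0)"
  proof (cases "{u, v} \<in> E")
    case True
    then have "v \<in> N" using less.prems by (simp add: N_def)
    then show ?thesis using True finN by (simp add: sum.remove)
  next
    case False
    then have "v \<notin> N" by (simp add: N_def)
    then show ?thesis using False by simp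
  qed
  have "?f {u} * ?f {v} - wmatch E y W * ?f {u, v}
      = (\<Sum>w\<in>N - {v}. K w) + (if {u, v} \<in> E then (?f {u, v})\<^sup>2 else 0)"
    unfolding rec rec' S K_def
    by (simp add: sum_subtractf algebra_simps power2_eq_square flip: sum_distrib_left sum_distrib_right)
  then show ?case
    using sum_nonneg[of "N - {v}" K] K by simp
qed

end

section \<open>Multiplicities under vertex deletion\<close>

lemma monom_dvd_mult:
  fixes p q :: "real poly"
  assumes "monom 1 a dvd p" "monom 1 b dvd q" "n \<le> a + b"
  shows "monom 1 n dvd p * q"
proof -
  have "monom 1 n dvd (monom 1 (a + b) :: real poly)"
    using assms(3) by (simp add: monom_1_dvd_iff')
  also have "\<dots> = monom 1 a * monom 1 b" by (simp add: mult_monom)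
  also have "\<dots> dvd p * q" using assms(1,2) by (rule mult_dvd_mono)
  finally show ?thesis .
qed

locale matching_root = edge_set E for E :: "'a set set" +
  fixes \<theta> :: real
begin

text \<open>The shift by \<open>\<theta>\<close> moves the root to \<open>0\<close>, so that multiplicities can be read off coefficients.\<close>
definition g :: "'a set \<Rightarrow> real poly" where
  "g W = wmatch E (\<lambda>_. [:\<theta>, 1:]) W"

definition d :: "'a set \<Rightarrow> nat" where
  "d W = mult \<theta> W (induced_edges E W)"

lemma g_pcompose:
  assumes "finite W"
  shows "g W = pcompose (match_poly W (induced_edges E W)) [:\<theta>, 1:]"
proof -
  have "pcompose (wmatch E (\<lambda>_. [:0, 1:]) W) [:\<theta>, 1:] = wmatch E (\<lambda>v. pcompose [:0, 1:] [:\<theta>, 1:]) W"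
    by (rule wmatch_hom) (simp_all add: pcompose_add pcompose_mult pcompose_1)
  then show ?thesis
    by (simp add: g_def match_poly_wmatch[OF assms card2] pcompose_pCons)
qed

text \<open>The empty matching is the only one of size \<open>0\<close>, so the polynomial is
  monic.\<close>

lemma match_poly_nz:
  assumes "finite W"
  shows "match_poly W (induced_edges E W) \<noteq> 0"
proof -
  have "finite (induced_edges E W)"
    using assms by (auto simp: induced_edges_def intro: finite_subset[of _ "Pow W"])
  then have "{M. M \<subseteq> induced_edges E W \<and> card M = 0 \<and> pairwise disjnt M} = {{}}"
    by (auto dest: finite_subset)
  then have "nmatch (induced_edges E W) 0 = 1"
    by (simp add: nmatch_def)
  moreover have "coeff (match_poly W (induced_edges E W)) (card W)
      = (\<Sum>r\<le>card W div 2. if r = 0 then real (nmatch (induced_edges E W) 0) else 0)"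
    unfolding match_poly_def coeff_sum by (rule sum.cong) auto
  ultimately have "coeff (match_poly W (induced_edges E W)) (card W) = 1"
    by simp
  then show ?thesis by auto
qed

lemma g_nz:
  assumes "finite W"
  shows "g W \<noteq> 0"
  unfolding g_pcompose[OF assms] using match_poly_nz[OF assms] by (simp add: pcompose_eq_0_iff)

lemma d_order:
  assumes "finite W"
  shows "d W = order 0 (g W)"
  by (simp add: d_def mult_def g_pcompose[OF assms] order_pcompose_shift match_poly_nz[OF assms])

lemma monom_dvd_g: "finite W \<Longrightarrow> n \<le> d W \<Longrightarrow> monom 1 n dvd g W"
  by (simp add: d_order monom_1_dvd_iff g_nz)

lemma g_rec:
  assumes "finite W" "u \<in> W"
  shows "g W = [:\<theta>, 1:] * g (W - {u}) - (\<Sum>w\<in>{w \<in> W - {u}. {u, w} \<in> E}. g (W - {u, w}))"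
  unfolding g_def by (rule wmatch_rec'[OF assms])

text \<open>Differentiate the expansion along \<open>u\<close>: its linear factor yields
  \<open>g (W - {u})\<close>, and after exchanging the sums the rest regroups into the expansions of
  \<open>g (W - {v})\<close> along \<open>u\<close>.\<close>

lemma pderiv_g:
  assumes "finite W"
  shows "pderiv (g W) = (\<Sum>v\<in>W. g (W - {v}))"
  using assms
proof (induction "card W" arbitrary: W rule: less_induct)
  case less
  show ?case
  proof (cases "W = {}")
    case True
    then show ?thesis by (simp add: g_def wmatch_empty)
  next
    case False
    then obtain u where u: "u \<in> W" by auto
    define N where "N = {w \<in> W - {u}. {u, w} \<in> E}"
    have finN: "finite N" using less.prems by (simp add: N_def)
    have IH: "pderiv (g (W - X)) = (\<Sum>v\<in>W - X. g (W - insert v X))" if "u \<in> X" for X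
    proof -
      have "W - X - {v} = W - insert v X" for v by auto
      moreover have "pderiv (g (W - X)) = (\<Sum>v\<in>W - X. g (W - X - {v}))"
        by (rule less.hyps) (use less.prems u that in \<open>auto intro: psubset_card_mono\<close>)
      ultimately show ?thesis by simp
    qed
    have step: "g (W - {v}) = [:\<theta>, 1:] * g (W - {v, u}) - (\<Sum>w\<in>{w. w \<in> N \<and> v \<noteq> w}. g (W - {v, u, w}))"
      if "v \<in> W - {u}" for v
    proof -
      have "{w \<in> W - {v} - {u}. {u, w} \<in> E} = {w. w \<in> N \<and> v \<noteq> w}" by (auto simp: N_def)
      moreover have "W - {v} - {u} = W - {v, u}" "W - {v} - {u, w} = W - {v, u, w}" for w by auto
      ultimately show ?thesis
        using g_rec[of "W - {v}" u] less.prems u that by auto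
    qed
    have "pderiv (g W) = g (W - {u}) + [:\<theta>, 1:] * (\<Sum>v\<in>W - {u}. g (W - {v, u}))
        - (\<Sum>w\<in>N. \<Sum>v\<in>W - {u, w}. g (W - {v, u, w}))"
      using g_rec[OF less.prems u] IH[of "{u}"] IH[of "{u, _}"]
      by (simp add: N_def pderiv_diff pderiv_add pderiv_smult higher_pderiv_sum[of 1, simplified] pderiv_pCons)
    also have "(\<Sum>w\<in>N. \<Sum>v\<in>W - {u, w}. g (W - {v, u, w}))
        = (\<Sum>w\<in>N. \<Sum>v\<in>{v. v \<in> W - {u} \<and> v \<noteq> w}. g (W - {v, u, w}))"
      by (rule sum.cong[OF refl], rule sum.cong) auto
    also have "\<dots> = (\<Sum>v\<in>W - {u}. \<Sum>w\<in>{w. w \<in> N \<and> v \<noteq> w}. g (W - {v, u, w}))"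
      by (rule sum.swap_restrict[symmetric]) (use less.prems finN in auto)
    finally have "pderiv (g W) = g (W - {u}) + (\<Sum>v\<in>W - {u}. g (W - {v}))"
      using step by (simp add: sum_distrib_left sum_subtractf)
    then show ?thesis
      using less.prems u by (simp add: sum.remove)
  qed
qed

section \<open>Interlacing and positivity of special vertices\<close>

lemma rayleigh_poly:
  fixes x :: "'a \<Rightarrow> real poly"
  assumes "finite W" "u \<in> W" "v \<in> W" "u \<noteq> v"
  shows "0 \<le> poly (wmatch E x (W - {u}) * wmatch E x (W - {v}) - wmatch E x W * wmatch E x (W - {u, v})) z"
  using rayleigh[OF assms, of "\<lambda>v. poly (x v) z"]
  by (simp add: poly_wmatch split: if_splits) (smt (verit) zero_le_power2)

lemma rayleigh_g:
  assumes "finite W" "u \<in> W" "v \<in> W" "u \<noteq> v"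
  shows "0 \<le> poly (g (W - {u}) * g (W - {v}) - g W * g (W - {u, v})) z"
    and "{u, v} \<in> E \<Longrightarrow> (poly (g (W - {u, v})) z)\<^sup>2 \<le> poly (g (W - {u}) * g (W - {v}) - g W * g (W - {u, v})) z"
proof -
  show "0 \<le> poly (g (W - {u}) * g (W - {v}) - g W * g (W - {u, v})) z"
    unfolding g_def by (rule rayleigh_poly[OF assms])
  show "(poly (g (W - {u, v})) z)\<^sup>2 \<le> poly (g (W - {u}) * g (W - {v}) - g W * g (W - {u, v})) z"
    if "{u, v} \<in> E"
    using rayleigh[OF assms, of "\<lambda>v. poly [:\<theta>, 1:] z"] that by (simp add: g_def poly_wmatch)
qed

text \<open>The Wronskian \<open>p\<close> of \<open>g (W - {u})\<close> and \<open>g W\<close> is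
  the square of \<open>g (W - {u})\<close> plus Rayleigh differences, hence dominates that square;
  but it vanishes to order at least \<open>d W + d (W - {u}) - 1\<close>.\<close>

lemma d_le_Suc_d_del:
  assumes "finite W" "u \<in> W"
  shows "d W \<le> d (W - {u}) + 1"
proof (cases "d W = 0")
  case False
  define p where "p = g (W - {u}) * pderiv (g W) - g W * pderiv (g (W - {u}))"
  have fin: "finite (W - {u})" using assms by simp
  have del: "W - {u} - {v} = W - {u, v}" for v by auto
  have p: "p = g (W - {u}) * g (W - {u})
      + (\<Sum>v\<in>W - {u}. g (W - {u}) * g (W - {v}) - g W * g (W - {u, v}))"
    unfolding p_def pderiv_g[OF assms(1)] pderiv_g[OF fin] del
    using assms by (simp add: sum.remove[of W u] sum_subtractf sum_distrib_left algebra_simps)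
  let ?n = "d W + d (W - {u}) - 1"
  have "monom 1 (d (W - {u})) dvd g (W - {u})" "monom 1 (d W) dvd g W"
    using assms by (simp_all add: monom_dvd_g)
  then have "monom 1 ?n dvd p" unfolding p_def
    using False by (intro dvd_diff) (auto intro!: monom_dvd_mult monom_dvd_pderiv)
  moreover have "(poly (g (W - {u})) z)\<^sup>2 \<le> poly p z" for z
  proof -
    have "0 \<le> (\<Sum>v\<in>W - {u}. poly (g (W - {u}) * g (W - {v}) - g W * g (W - {u, v})) z)"
      by (rule sum_nonneg) (use rayleigh_g(1) assms in auto)
    then show ?thesis unfolding p by (simp add: poly_sum power2_eq_square)
  qed
  ultimately have "?n \<le> 2 * order 0 (g (W - {u}))"
    using order_of_square_le g_nz[OF fin] by blast
  then show ?thesis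
    using False by (simp add: d_order[OF fin])
qed simp

text \<open>By the previous bound, every term in the expansion along \<open>u\<close> vanishes to
  order at least \<open>d (W - {u}) - 1\<close>.\<close>

lemma d_del_le_Suc_d:
  assumes "finite W" "u \<in> W"
  shows "d (W - {u}) \<le> d W + 1"
proof -
  let ?n = "d (W - {u}) - 1"
  have "monom 1 ?n dvd g (W - {u, w})" if "w \<in> W - {u}" for w
  proof -
    have "W - {u} - {w} = W - {u, w}" by auto
    then have "?n \<le> d (W - {u, w})"
      using d_le_Suc_d_del[of "W - {u}" w] assms that by simp
    then show ?thesis using assms by (simp add: monom_dvd_g)
  qed
  then have "monom 1 ?n dvd g W"
    unfolding g_rec[OF assms] by (intro dvd_diff dvd_mult dvd_sum) (auto intro: monom_dvd_g simp: assms)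
  then have "?n \<le> d W"
    using assms by (simp add: d_order monom_1_dvd_iff g_nz)
  then show ?thesis by simp
qed

lemma interlacing:
  assumes "finite W" "u \<in> W" "u \<notin> X"
  shows "d (W - X) \<le> d (W - insert u X) + 1" "d (W - insert u X) \<le> d (W - X) + 1"
proof -
  have "W - X - {u} = W - insert u X" by auto
  then show "d (W - X) \<le> d (W - insert u X) + 1" "d (W - insert u X) \<le> d (W - X) + 1"
    using d_le_Suc_d_del[of "W - X" u] d_del_le_Suc_d[of "W - X" u] assms by simp_all
qed

text \<open>The derivative, a sum over vertex deletions, vanishes to order exactly
  \<open>d W - 1\<close>, so some summand vanishes to no higher order.\<close>

lemma essential_exists:
  assumes "finite W" "d W > 0"
  shows "\<exists>u\<in>W. d (W - {u}) + 1 = d W"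
proof (rule ccontr)
  assume none: "\<not> ?thesis"
  have "d W \<le> d (W - {u})" if "u \<in> W" for u
    using none that d_le_Suc_d_del[OF assms(1) that] by fastforce
  then have "coeff (g (W - {u})) (d W - 1) = 0" if "u \<in> W" for u
    using that assms by (intro coeff_less_order) (force simp: d_order[symmetric])
  then have "coeff (pderiv (g W)) (d W - 1) = 0"
    by (simp add: pderiv_g[OF assms(1)] coeff_sum)
  then have "coeff (g W) (d W) = 0"
    using assms(2) by (simp add: coeff_pderiv)
  then show False
    using coeff_order_nz[OF g_nz[OF assms(1)]] assms(1) by (simp add: d_order)
qed

text \<open>By interlacing, the Rayleigh difference vanishes to order at least
  \<open>2 * d W - 2\<close>; on an edge it dominates the square of
  \<open>g (W - {u, v})\<close>.\<close>

lemma edge_deletion: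
  assumes "finite W" "u \<in> W" "v \<in> W" "{u, v} \<in> E"
  shows "d W \<le> d (W - {u, v}) + 1"
proof -
  have uv: "u \<noteq> v" using card2[OF assms(4)] by auto
  have i: "d W \<le> d (W - {u}) + 1" "d W \<le> d (W - {v}) + 1" "d (W - {u}) \<le> d (W - {u, v}) + 1"
    using interlacing(1)[of W u "{}"] interlacing(1)[of W v "{}"] interlacing(1)[of W v "{u}"] assms uv
    by (simp_all add: insert_commute)
  have m: "monom 1 (d (W - X)) dvd g (W - X)" for X using assms by (simp add: monom_dvd_g)
  have "2 * d W - 2 \<le> 2 * order 0 (g (W - {u, v}))"
  proof (rule order_of_square_le)
    show "monom 1 (2 * d W - 2) dvd g (W - {u}) * g (W - {v}) - g W * g (W - {u, v})"
      using i by (intro dvd_diff monom_dvd_mult[OF m m] monom_dvd_mult[OF m[of "{}", simplified] m]) auto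
  qed (use rayleigh_g(2)[OF assms(1-3) uv assms(4)] g_nz assms in auto)
  then show ?thesis using assms by (simp add: d_order)
qed

text \<open>By interlacing only neutrality of \<open>a\<close> has to be excluded. Then
  \<open>g (W - {a}) * g (W - {b})\<close> would have odd order \<open>2 * d W - 1\<close>, which
  conflicts with the Rayleigh inequality on the edge.\<close>

lemma special_positive:
  assumes "finite W" "a \<in> W" "b \<in> W" "{a, b} \<in> E"
    and b: "d (W - {b}) + 1 = d W" and a: "d (W - {a}) + 1 \<noteq> d W"
  shows "d (W - {a}) = d W + 1"
proof (rule ccontr)
  assume np: "d (W - {a}) \<noteq> d W + 1"
  have ab: "a \<noteq> b" using card2[OF assms(4)] by auto
  have i: "d (W - {b}) \<le> d (W - {a, b}) + 1" "d (W - {a, b}) \<le> d (W - {b}) + 1"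
      "d (W - {a}) \<le> d (W - {a, b}) + 1" "d W \<le> d (W - {a}) + 1" "d (W - {a}) \<le> d W + 1"
    using interlacing[of W a "{}"] interlacing[of W a "{b}"] interlacing[of W b "{a}"] assms(1-3) ab
    by (simp_all add: insert_commute)
  then have a': "d (W - {a}) = d W" using a np by simp
  let ?p = "g (W - {a}) * g (W - {b})" and ?q = "g W * g (W - {a, b})"
  have nz: "g (W - X) \<noteq> 0" "g W \<noteq> 0" for X using assms(1) g_nz by auto
  have op: "order 0 ?p = d (W - {a}) + d (W - {b})" and oq: "order 0 ?q = d W + d (W - {a, b})"
    using assms(1) nz by (simp_all add: order_mult d_order)
  show False
  proof (cases "d (W - {a, b}) = d W")
    case True
    \<comment> \<open>The odd order of \<open>?p\<close> passes to the nonnegative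
      difference.\<close>
    have "order 0 ?p < order 0 ?q" using True b a' op oq by simp
    then have "even (order 0 ?p)"
      using order_diff_less[of ?p ?q] order_nonneg_even[of "?p - ?q"] rayleigh_g(1)[OF assms(1-3) ab] nz
      by (metis mult_eq_0_iff)
    then show False using op a' b by presburger
  next
    case False
    then have ab': "d (W - {a, b}) + 1 = d W" using i b a' by simp
    \<comment> \<open>Both products have order \<open>2 * d W - 1\<close>, while the dominated
      square has order only \<open>2 * d W - 2\<close>.\<close>
    have "monom 1 (2 * d W - 1) dvd ?p - ?q"
      using op oq a' b ab' nz by (intro dvd_diff) (simp_all add: monom_1_dvd_iff)
    then have "2 * d W - 1 \<le> 2 * order 0 (g (W - {a, b}))"
      using order_of_square_le rayleigh_g(2)[OF assms(1-3) ab assms(4)] nz by blast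
    then show False using ab' assms(1) by (simp add: d_order)
  qed
qed

section \<open>Perturbing a third weight: stability and Gallai's lemma\<close>

text \<open>The Rayleigh inequality for \<open>u\<close>, \<open>v\<close> stays valid when the weight of a third vertex \<open>b\<close> is
  changed to \<open>x + \<sigma> (x - \<theta>)\<close>; its lowest coefficient is affine in \<open>\<sigma>\<close>, hence must be constant.\<close>
lemma perturbed_rayleigh:
  assumes fin: "finite W" and uvb: "u \<in> W" "v \<in> W" "b \<in> W" "u \<noteq> v" "u \<noteq> b" "v \<noteq> b"
    and b: "d (W - {b}) + 1 = d W" and uv: "d (W - {u, v}) \<le> d (W - {u, v, b})"
    and s: "d W + d (W - {u, v}) \<le> d (W - {u}) + d (W - {v})"
      "d W + d (W - {u, v}) \<le> d (W - {u}) + d (W - {v, b})"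
      "d W + d (W - {u, v}) \<le> d (W - {u, b}) + d (W - {v})"
      "d W + d (W - {u, v}) \<le> d (W - {u, b}) + d (W - {v, b}) + 1"
  shows False
\<comment> \<open>Here \<open>m = d W\<close> and \<open>n = d (W - {u, v})\<close>; primed
  polynomials have \<open>b\<close> deleted in addition. Essentiality of \<open>b\<close> gives
  \<open>C'\<close> the order \<open>m - 1\<close>.\<close>
proof (rule no_perturbation)
  fix \<sigma> z
  have F: "wmatch E ((\<lambda>_. [:\<theta>, 1:])(b := [:\<theta>, 1:] + [:0, \<sigma>:])) (W - X)
      = g (W - X) + [:0, \<sigma>:] * g (W - insert b X)" if "b \<notin> X" for X
  proof -
    have "W - X - {b} = W - insert b X" by auto
    then show ?thesis
      using wmatch_perturb[of "W - X" b "\<lambda>_. [:\<theta>, 1:]" "[:0, \<sigma>:]"] fin uvb that by (simp add: g_def)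
  qed
  show "0 \<le> poly ((g (W - {u}) + [:0, \<sigma>:] * g (W - {u, b})) * (g (W - {v}) + [:0, \<sigma>:] * g (W - {v, b}))
      - (g W + [:0, \<sigma>:] * g (W - {b})) * (g (W - {u, v}) + [:0, \<sigma>:] * g (W - {u, v, b}))) z"
    using rayleigh_poly[OF fin uvb(1,2,4), of "(\<lambda>_. [:\<theta>, 1:])(b := [:\<theta>, 1:] + [:0, \<sigma>:])" z]
      F[of "{u}"] F[of "{v}"] F[of "{}"] F[of "{u, v}"] uvb
    by (simp add: insert_commute)
qed (use assms g_nz in \<open>auto simp: d_order\<close>)

text \<open>As \<open>a\<close> is positive in \<open>W\<close>, this amounts to saying that
  deleting \<open>a\<close> preserves the type of every other vertex \<open>v\<close>. If it failed,
  interlacing would leave few values, each refuted by the Rayleigh inequality.\<close>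

lemma stability:
  assumes fin: "finite W" and W: "a \<in> W" "b \<in> W" "v \<in> W" "{a, b} \<in> E" "v \<noteq> a"
    and b: "d (W - {b}) + 1 = d W" and a: "d (W - {a}) + 1 \<noteq> d W"
  shows "d (W - {a, v}) = d (W - {v}) + 1"
proof (rule ccontr)
  assume neq: "d (W - {a, v}) \<noteq> d (W - {v}) + 1"
  have ab: "a \<noteq> b" using card2[OF W(4)] by auto
  have pos: "d (W - {a}) = d W + 1" by (rule special_positive[OF fin W(1,2,4) b a])
  have iv: "d W \<le> d (W - {v}) + 1" "d (W - {v}) \<le> d W + 1"
    and iav: "d (W - {a}) \<le> d (W - {a, v}) + 1" "d (W - {a, v}) \<le> d (W - {v}) + 1"
    using interlacing[of W v "{}"] interlacing[of W v "{a}"] interlacing[of W a "{v}"] fin W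
    by (simp_all add: insert_commute)
  then have v: "d W \<le> d (W - {v})" "d W \<le> d (W - {a, v})" "d (W - {a, v}) \<le> d (W - {v})"
    using pos neq by auto
  then have vb: "v \<noteq> b" using b by auto
  have i: "d (W - {v}) \<le> d (W - {v, b}) + 1" "d (W - {v, b}) \<le> d (W - {b}) + 1"
    "d (W - {a}) \<le> d (W - {a, b}) + 1" "d (W - {a, b}) \<le> d (W - {b}) + 1"
    "d (W - {a, v}) \<le> d (W - {a, v, b}) + 1"
    using interlacing[of W b "{v}"] interlacing[of W v "{b}"] interlacing[of W b "{a}"]
      interlacing[of W a "{b}"] interlacing[of W b "{a, v}"] fin W ab vb
    by (simp_all add: insert_commute)
  have Wv: "W - {v} - {b} = W - {v, b}" "W - {v} - {a} = W - {a, v}" "W - {v} - {a, b} = W - {a, v, b}"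
    by auto
  \<comment> \<open>If \<open>b\<close> stays essential in \<open>W - {v}\<close>, then
    \<open>a\<close>, not being positive there, must be essential too.\<close>
  have sp: "d (W - {v, b}) + 1 = d (W - {v}) \<Longrightarrow> d (W - {a, v}) + 1 = d (W - {v})"
    using special_positive[of "W - {v}" a b] fin W ab vb neq unfolding Wv by auto
  have ed: "d (W - {v}) \<le> d (W - {a, v, b}) + 1"
    using edge_deletion[of "W - {v}" a b] fin W ab vb unfolding Wv by auto
  have av: "d (W - {a, v}) = d W"
    using v sp i b iv by linarith
  show False
  proof (cases "d W \<le> d (W - {a, v, b})")
    case True
    \<comment> \<open>Perturb the weight of \<open>b\<close> in the Rayleigh inequality for
      \<open>v\<close> and \<open>a\<close>.\<close>
    show False
      by (rule perturbed_rayleigh[of W v a b])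
        (use fin W ab vb b True av pos v i in \<open>auto simp: insert_commute\<close>)
  next
    case False
    then have avb: "d (W - {a, v, b}) + 1 = d W" using i av by simp
    then have v': "d (W - {v}) = d W" using ed v by simp
    then have vb': "d (W - {v, b}) = d W" using sp i b av by fastforce
    \<comment> \<open>In \<open>W - {v}\<close> the Rayleigh products for \<open>a\<close>,
      \<open>b\<close> have orders \<open>2 * d W\<close> and \<open>2 * d W - 1\<close>, so the
      nonnegative difference would have odd order.\<close>
    let ?p = "g (W - {a, v}) * g (W - {v, b})" and ?q = "g (W - {v}) * g (W - {a, v, b})"
    have nz: "g (W - X) \<noteq> 0" for X using g_nz fin by simp
    have op: "order 0 ?p = 2 * d W" and oq: "order 0 ?q + 1 = 2 * d W"
      using nz fin av v' vb' avb by (simp_all add: order_mult flip: d_order)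
    have "0 \<le> poly (?p - ?q) z" for z
      using rayleigh_g(1)[of "W - {v}" a b] fin W ab vb unfolding Wv by auto
    then have "even (order 0 (?p - ?q))"
      using order_diff_less(2)[of ?q ?p] op oq nz by (intro order_nonneg_even) auto
    moreover have "order 0 (?p - ?q) = order 0 ?q"
      using order_diff_less(1)[of ?q ?p] op oq nz order_uminus[of 0 "?q - ?p"] by simp
    ultimately show False using oq by presburger
  qed
qed

text \<open>Two essential vertices are parallel if deleting both costs only one. Were
  \<open>u\<close>, \<open>w\<close> not parallel, perturbing the weight of \<open>v\<close> in
  their Rayleigh inequality would violate it.\<close>

lemma essential_parallel_trans:
  assumes fin: "finite W" and W: "u \<in> W" "v \<in> W" "w \<in> W" "u \<noteq> v" "v \<noteq> w" "u \<noteq> w"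
    and ess: "d (W - {u}) + 1 = d W" "d (W - {v}) + 1 = d W" "d (W - {w}) + 1 = d W"
    and par: "d W \<le> d (W - {u, v}) + 1" "d W \<le> d (W - {v, w}) + 1"
  shows "d W \<le> d (W - {u, w}) + 1"
proof (rule ccontr)
  assume "\<not> ?thesis"
  moreover have "d (W - {u}) \<le> d (W - {u, w}) + 1" "d (W - {u, v}) \<le> d (W - {u, w, v}) + 1"
    using interlacing[of W w "{u}"] interlacing[of W w "{u, v}"] fin W by (simp_all add: insert_commute)
  ultimately show False
    using perturbed_rayleigh[of W u w v] fin W ess par by (simp add: insert_commute)
qed

text \<open>Adjacent vertices are parallel by \<open>edge_deletion\<close>, and transitivity along
  paths makes \<open>u\<close> parallel to all others. Multiplicity above one would give
  \<open>C - {u}\<close> an essential vertex, which is not parallel to \<open>u\<close>.\<close>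

lemma gallai:
  assumes fin: "finite C" and con: "connected_graph C (induced_edges E C)"
    and ess: "\<And>u. u \<in> C \<Longrightarrow> d (C - {u}) + 1 = d C"
  shows "d C = 1"
proof (rule ccontr)
  assume "d C \<noteq> 1"
  obtain u where u: "u \<in> C" using con by (auto simp: connected_graph_def)
  have par: "d C \<le> d (C - {u, w}) + 1" if "w \<in> C" "w \<noteq> u" for w
  proof -
    have "(u, w) \<in> (adj_rel C (induced_edges E C))\<^sup>*"
      using con u that by (auto simp: connected_graph_def)
    then have "w \<noteq> u \<longrightarrow> d C \<le> d (C - {u, w}) + 1"
    proof (induction rule: rtrancl_induct)
      case (step v w)
      then have vw: "v \<in> C" "w \<in> C" "{v, w} \<in> E" by (auto simp: adj_rel_def induced_edges_def)
      then have "v \<noteq> w" using card2 by fastforce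
      have e: "d C \<le> d (C - {v, w}) + 1" by (rule edge_deletion[OF fin vw])
      show ?case
      proof (intro impI)
        assume "w \<noteq> u"
        show "d C \<le> d (C - {u, w}) + 1"
        proof (cases "v = u")
          case False
          then show ?thesis
            using essential_parallel_trans[OF fin u vw(1,2)] step.IH e ess u vw \<open>v \<noteq> w\<close> \<open>w \<noteq> u\<close> by auto
        qed (use e in simp)
      qed
    qed simp
    with that show ?thesis by simp
  qed
  have "d (C - {u}) > 0" using ess[OF u] \<open>d C \<noteq> 1\<close> by simp
  then obtain w where w: "w \<in> C" "w \<noteq> u" "d (C - {u} - {w}) + 1 = d (C - {u})"
    using essential_exists[of "C - {u}"] fin by auto
  have "C - {u} - {w} = C - {u, w}" by auto
  then show False using par[OF w(1,2)] w(3) ess[OF u] by simp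
qed

text \<open>Delete \<open>X\<close> one vertex at a time. The second claim keeps the next vertex
  \<open>a\<close> nonessential and its neighbour \<open>b\<close> essential, so \<open>a\<close> is
  still special when its turn comes.\<close>

lemma stability_set:
  assumes fin: "finite V"
    and X: "finite X" "X \<subseteq> {a \<in> V. d (V - {a}) + 1 \<noteq> d V \<and> (\<exists>b\<in>V. {a, b} \<in> E \<and> d (V - {b}) + 1 = d V)}"
  shows "d (V - X) = d V + card X" (is ?A)
    and "\<And>v. v \<in> V - X \<Longrightarrow> d (V - insert v X) = d (V - {v}) + card X"
proof -
  have "d (V - X) = d V + card X \<and> (\<forall>v\<in>V - X. d (V - insert v X) = d (V - {v}) + card X)"
    using X
  proof (induction X rule: finite_induct)
    case (insert a X)
    let ?W = "V - X"
    obtain b where b: "b \<in> V" "{a, b} \<in> E" "d (V - {b}) + 1 = d V" and a: "a \<in> V" "d (V - {a}) + 1 \<noteq> d V"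
      using insert.prems by auto
    have bX: "b \<notin> X" using insert.prems b(3) by auto
    have IH: "d ?W = d V + card X" "\<And>v. v \<in> ?W \<Longrightarrow> d (V - insert v X) = d (V - {v}) + card X"
      using insert by auto
    have del: "?W - {v} = V - insert v X" for v by auto
    have W: "finite ?W" "a \<in> ?W" "b \<in> ?W" using fin a b bX insert.hyps by auto
    have ess: "d (?W - {b}) + 1 = d ?W" "d (?W - {a}) + 1 \<noteq> d ?W"
      unfolding del using IH W a b by auto
    have "d (?W - {a}) = d ?W + 1"
      using special_positive[OF W b(2) ess] .
    moreover have "d (V - insert v (insert a X)) = d (V - {v}) + card (insert a X)" if "v \<in> V - insert a X" for v
    proof -
      have "?W - {a, v} = V - insert v (insert a X)" by auto
      then show ?thesis
        using stability[OF W _ b(2) _ ess, of v] that IH(2)[of v] insert.hyps unfolding del by simp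
    qed
    ultimately show ?case
      using IH(1) insert.hyps unfolding del by auto
  qed simp
  then show ?A "\<And>v. v \<in> V - X \<Longrightarrow> d (V - insert v X) = d (V - {v}) + card X" by auto
qed

section \<open>Disjoint unions and universal vertices\<close>

lemma d_union:
  assumes "finite C" "finite D" "C \<inter> D = {}" "\<And>u w. u \<in> C \<Longrightarrow> w \<in> D \<Longrightarrow> {u, w} \<notin> E"
  shows "d (C \<union> D) = d C + d D"
proof -
  have "g (C \<union> D) = g C * g D"
    unfolding g_def by (rule wmatch_union[OF assms])
  then show ?thesis using assms g_nz by (simp add: d_order order_mult)
qed

text \<open>A vertex adjacent to all others turns \<open>f\<close> into \<open>x f - f'\<close>.\<close>
lemma d_insert_universal:
  assumes fin: "finite W" and a: "a \<notin> W" and adj: "\<And>w. w \<in> W \<Longrightarrow> {a, w} \<in> E" and pos: "d W > 0"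
  shows "d (insert a W) + 1 = d W"
proof -
  have N: "{w \<in> insert a W - {a}. {a, w} \<in> E} = W" using a adj by auto
  have del: "insert a W - {a} = W" "insert a W - {a, w} = W - {w}" for w using a by auto
  have g: "g (insert a W) = [:\<theta>, 1:] * g W - pderiv (g W)"
    using g_rec[of "insert a W" a, unfolded N, unfolded del] fin unfolding pderiv_g[OF fin] by simp
  have z: "coeff (g W) i = 0" if "i < d W" for i
    using that fin by (simp add: coeff_less_order d_order)
  \<comment> \<open>The product term vanishes to order at least \<open>d W\<close>, the derivative
    to order exactly \<open>d W - 1\<close>.\<close>
  have "order 0 (g (insert a W)) = d W - 1"
  proof (rule order_0_eqI)
    show "coeff (g (insert a W)) i = 0" if "i < d W - 1" for i
      unfolding g using that z by (simp add: coeff_pderiv coeff_pCons split: nat.split)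
    have "coeff (g W) (d W) \<noteq> 0"
      using coeff_order_nz[OF g_nz[OF fin]] fin by (simp add: d_order)
    then show "coeff (g (insert a W)) (d W - 1) \<noteq> 0"
      unfolding g using pos z by (simp add: coeff_pderiv coeff_pCons split: nat.split)
  qed
  then show ?thesis using pos fin by (simp add: d_order)
qed

text \<open>The bound on \<open>card X\<close> keeps the multiplicity positive before each further
  vertex is added.\<close>

lemma d_join_universal:
  assumes "finite X" "finite D" "X \<inter> D = {}"
    and "\<And>a w. a \<in> X \<Longrightarrow> w \<in> X \<union> D \<Longrightarrow> w \<noteq> a \<Longrightarrow> {a, w} \<in> E" and "card X \<le> d D"
  shows "d (X \<union> D) + card X = d D"
  using assms
proof (induction X rule: finite_induct)
  case (insert a X)
  then have IH: "d (X \<union> D) + card X = d D" by auto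
  have "d (insert a (X \<union> D)) + 1 = d (X \<union> D)"
    by (rule d_insert_universal) (use insert IH in auto)
  then show ?case using IH insert.hyps by simp
qed simp

end

section \<open>Connected components\<close>

lemma adj_rel_induced: "adj_rel U (induced_edges E U) = {(x, y). x \<in> U \<and> y \<in> U \<and> {x, y} \<in> E}"
  by (auto simp: adj_rel_def induced_edges_def)

lemma sym_rtrancl_adj_rel: "sym ((adj_rel U F)\<^sup>*)"
  by (rule sym_rtrancl) (auto simp: sym_def adj_rel_def insert_commute)

lemma component_subset:
  assumes "C \<in> components U F"
  shows "C \<subseteq> U"
proof
  fix x assume "x \<in> C"
  then obtain v where "(v, x) \<in> (adj_rel U F)\<^sup>*" "v \<in> U"
    using assms by (auto simp: components_def)
  then show "x \<in> U" by (cases rule: rtranclE) (auto simp: adj_rel_def)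
qed

lemma component_eq:
  assumes "C \<in> components U F" "x \<in> C"
  shows "C = (adj_rel U F)\<^sup>* `` {x}"
proof -
  obtain v where v: "C = (adj_rel U F)\<^sup>* `` {v}"
    using assms by (auto simp: components_def)
  then have "(v, x) \<in> (adj_rel U F)\<^sup>*" using assms by simp
  moreover then have "(x, v) \<in> (adj_rel U F)\<^sup>*" using sym_rtrancl_adj_rel by (metis symD)
  ultimately show ?thesis unfolding v by (auto intro: rtrancl_trans)
qed

lemma component_unique:
  "C \<in> components U F \<Longrightarrow> D \<in> components U F \<Longrightarrow> x \<in> C \<Longrightarrow> x \<in> D \<Longrightarrow> C = D"
  using component_eq by metis

lemma component_exists: "x \<in> U \<Longrightarrow> \<exists>C\<in>components U F. x \<in> C"
  by (auto simp: components_def)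

lemma component_no_edge:
  assumes "C \<in> components U (induced_edges E U)" "x \<in> C" "y \<in> U - C"
  shows "{x, y} \<notin> E"
proof
  assume "{x, y} \<in> E"
  then have "(x, y) \<in> adj_rel U (induced_edges E U)"
    using assms component_subset[OF assms(1)] by (auto simp: adj_rel_induced)
  then show False using component_eq[OF assms(1,2)] assms(3) by auto
qed

text \<open>No edge leaves a component, so a path in \<open>U\<close> between vertices of
  \<open>C\<close> stays in \<open>C\<close>.\<close>

lemma component_connected:
  assumes "C \<in> components U (induced_edges E U)"
  shows "connected_graph C (induced_edges E C)"
  unfolding connected_graph_def
proof (intro conjI ballI)
  show "C \<noteq> {}" using assms by (auto simp: components_def)
  fix x y assume x: "x \<in> C" and y: "y \<in> C"
  have "(x, y) \<in> (adj_rel U (induced_edges E U))\<^sup>*"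
    using component_eq[OF assms x] y by auto
  then have "y \<in> C \<longrightarrow> (x, y) \<in> (adj_rel C (induced_edges E C))\<^sup>*"
  proof (induction rule: rtrancl_induct)
    case (step y z)
    then have e: "y \<in> U" "z \<in> U" "{y, z} \<in> E" by (auto simp: adj_rel_induced)
    then have "z \<in> C \<Longrightarrow> y \<in> C"
      using component_no_edge[OF assms, of z y] by (auto simp: insert_commute)
    then show ?case using step.IH e by (auto simp: adj_rel_induced intro: rtrancl_into_rtrancl)
  qed simp
  with y show "(x, y) \<in> (adj_rel C (induced_edges E C))\<^sup>*" by simp
qed

section \<open>The graph S\<close>

lemma graph_S_edges: "graph V E \<Longrightarrow> graph V (S_edges \<theta> V E)"
  by (auto simp: graph_def S_edges_def Aset_def card_2_iff doubleton_eq_iff)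

lemma induced_edges_S_edges:
  "U \<inter> Aset \<theta> V E = {} \<Longrightarrow> induced_edges (S_edges \<theta> V E) U = induced_edges E U"
  by (auto simp: S_edges_def induced_edges_def)

lemma induced_edges_graph: "graph V E \<Longrightarrow> induced_edges E V = E"
  by (auto simp: graph_def induced_edges_def)

lemma induced_edges_induced: "induced_edges (induced_edges E C) (C - X) = induced_edges E (C - X)"
  by (auto simp: induced_edges_def)

theorem theorem5p9:
  fixes V :: "'a set" and E :: "'a set set" and \<theta> :: real and u v :: 'a
  assumes G: "graph V E"
    and m2: "mult \<theta> V E \<ge> 2"
    and uV: "u \<in> V" and vV: "v \<in> V" and uv: "u \<noteq> v"
  shows "del_mult \<theta> V (S_edges \<theta> V E) {u, v} = mult \<theta> V (S_edges \<theta> V E) \<longleftrightarrow>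
    ((u \<in> Pset \<theta> V E \<union> Aset \<theta> V E \<and> v \<in> Bset \<theta> V E) \<or>
     (v \<in> Pset \<theta> V E \<union> Aset \<theta> V E \<and> u \<in> Bset \<theta> V E)) \<or>
    (u \<in> Nset \<theta> V E \<and> v \<in> Nset \<theta> V E \<and>
     (\<exists>C1\<in>Qcomps \<theta> V E. \<exists>C2\<in>Qcomps \<theta> V E. C1 \<noteq> C2 \<and> u \<in> C1 \<and> v \<in> C2)) \<or>
    (\<exists>C\<in>Hcomps \<theta> V E. u \<in> C \<and> v \<in> C \<and> del_mult \<theta> C (induced_edges E C) {u, v} = 1) \<or>
    (\<exists>C\<in>Qcomps \<theta> V E. u \<in> C \<and> v \<in> C \<and> del_mult \<theta> C (induced_edges E C) {u, v} = 0)"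
    (is "?L \<longleftrightarrow> ?a \<or> ?b \<or> ?c \<or> ?d")
proof -
  interpret G: matching_root E \<theta>
    using G by unfold_locales (auto simp: graph_def)
  interpret S: matching_root "S_edges \<theta> V E" \<theta>
    using graph_S_edges[OF G] by unfold_locales (auto simp: graph_def)
  have fin: "finite V" using G by (simp add: graph_def)
  let ?A = "Aset \<theta> V E" and ?B = "Bset \<theta> V E" and ?P = "Pset \<theta> V E" and ?N = "Nset \<theta> V E"
  define U where "U = V - ?A"
  have AV: "?A \<subseteq> V" by (auto simp: Aset_def)
  have finA: "finite ?A" and finU: "finite U" using AV fin by (auto simp: U_def intro: finite_subset)
  have mG: "mult \<theta> V E = G.d V" by (simp add: G.d_def induced_edges_graph[OF G])
  have del: "del_mult \<theta> V E X = G.d (V - X)" for X by (simp add: G.d_def del_mult_def)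
  have mC: "mult \<theta> C (induced_edges E C) = G.d C" for C by (simp add: G.d_def)
  have delC: "del_mult \<theta> C (induced_edges E C) X = G.d (C - X)" for C X
    by (simp add: G.d_def del_mult_def induced_edges_induced)
  have ess: "essential \<theta> V E x \<longleftrightarrow> G.d (V - {x}) + 1 = G.d V" for x
    unfolding essential_def mG del by linarith
  have essC: "essential \<theta> C (induced_edges E C) x \<longleftrightarrow> G.d (C - {x}) + 1 = G.d C" for C x
    unfolding essential_def mC delC by linarith
  have A: "?A = {a \<in> V. G.d (V - {a}) + 1 \<noteq> G.d V \<and> (\<exists>b\<in>V. {a, b} \<in> E \<and> G.d (V - {b}) + 1 = G.d V)}"
    unfolding Aset_def special_def ess by simp
  have B: "x \<in> ?B \<longleftrightarrow> x \<in> V \<and> G.d (V - {x}) + 1 = G.d V" for x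
    by (simp add: Bset_def ess)
  have P: "x \<in> ?P \<longleftrightarrow> G.d (V - {x}) = G.d V + 1" if "x \<in> U" for x
    using that by (auto simp: Pset_def positive_def mG del U_def Aset_def)
  have N: "x \<in> ?N \<longleftrightarrow> G.d (V - {x}) = G.d V" if "x \<in> U" for x
    using that by (simp add: Nset_def neutral_def mG del U_def)
  have PA: "x \<notin> ?P" if "x \<in> ?A" for x using that by (simp add: Pset_def Aset_def)
  have BA: "x \<notin> ?B" if "x \<in> ?A" for x using that unfolding B A by simp
  have dU: "G.d U = G.d V + card ?A"
    unfolding U_def by (rule G.stability_set(1)[OF fin finA equalityD1[OF A]])
  have dUx: "G.d (U - {x}) = G.d (V - {x}) + card ?A" if "x \<in> U" for x
  proof -
    have "U - {x} = V - insert x ?A" by (auto simp: U_def)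
    then show ?thesis
      using G.stability_set(2)[OF fin finA equalityD1[OF A], of x] that by (simp add: U_def)
  qed

  \<comment> \<open>Reduction from S to G\<close>
  have SG: "S.d X = G.d X" if "X \<subseteq> U" for X
  proof -
    have "X \<inter> ?A = {}" using that by (auto simp: U_def)
    then show ?thesis by (simp add: S.d_def G.d_def induced_edges_S_edges)
  qed
  \<comment> \<open>Rebuild \<open>V - X\<close> from \<open>U - X\<close> by adding the vertices of
    \<open>?A - X\<close>, which are universal in S.\<close>
  have S: "S.d (V - X) + card (?A - X) = G.d (U - X)" if "card (?A - X) \<le> G.d (U - X)" for X
  proof -
    have "V - X = (?A - X) \<union> (U - X)" using AV by (auto simp: U_def)
    moreover have "S.d ((?A - X) \<union> (U - X)) + card (?A - X) = S.d (U - X)"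
    proof (rule S.d_join_universal)
      show "{a, w} \<in> S_edges \<theta> V E" if "a \<in> ?A - X" "w \<in> ?A - X \<union> (U - X)" "w \<noteq> a" for a w
        using that AV by (auto simp: S_edges_def U_def)
    qed (use that finA finU SG[of "U - X"] in \<open>auto simp: U_def\<close>)
    ultimately show ?thesis using SG[of "U - X"] by auto
  qed
  \<comment> \<open>Multiplicity at least two enters here: two deletions cost at most two, and
    \<open>U\<close> has multiplicity at least \<open>card ?A + 2\<close>.\<close>
  have ge: "card ?A \<le> G.d (U - {u, v})"
  proof -
    have "G.d (W - {x}) + 1 \<ge> G.d W" if "finite W" for W x
      using G.d_le_Suc_d_del[OF that, of x] by (cases "x \<in> W") auto
    from this[of U u] this[of "U - {u}" v] have "G.d U \<le> G.d (U - {u} - {v}) + 2"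
      using finU by auto
    moreover have "U - {u} - {v} = U - {u, v}" by auto
    ultimately show ?thesis using dU m2 mG by simp
  qed
  moreover have "card (?A - {u, v}) \<le> card ?A" using finA by (intro card_mono) auto
  ultimately have "S.d (V - {u, v}) + card (?A - {u, v}) = G.d (U - {u, v})"
    by (intro S) simp
  moreover have "S.d V = G.d V"
    using S[of "{}"] dU by simp
  moreover have "mult \<theta> V (S_edges \<theta> V E) = S.d V"
    by (simp add: S.d_def induced_edges_graph[OF graph_S_edges[OF G]])
  moreover have "del_mult \<theta> V (S_edges \<theta> V E) {u, v} = S.d (V - {u, v})"
    by (simp add: S.d_def del_mult_def)
  ultimately have L: "?L \<longleftrightarrow> G.d (U - {u, v}) = G.d V + card (?A - {u, v})"
    by auto

  \<comment> \<open>Components of \<open>U\<close>\<close>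
  define K where "K = components U (induced_edges E U)"
  have Q: "C \<in> Qcomps \<theta> V E \<longleftrightarrow> C \<in> K \<and> G.d C = 0" for C
    by (simp add: Qcomps_def K_def U_def mC)
  have H: "C \<in> Hcomps \<theta> V E \<longleftrightarrow> C \<in> K \<and> (\<forall>x\<in>C. G.d (C - {x}) + 1 = G.d C)" for C
    by (auto simp: Hcomps_def K_def U_def critical_def essC component_connected)
  have KU: "C \<subseteq> U" if "C \<in> K" for C
    using component_subset that by (auto simp: K_def)
  have QHA: "x \<notin> ?A" if "C \<in> Qcomps \<theta> V E \<or> C \<in> Hcomps \<theta> V E" "x \<in> C" for C x
    using that KU Q H by (auto simp: U_def)
  have split: "G.d (C \<union> D) = G.d C + G.d D" if "C \<subseteq> K'" "D \<subseteq> U - K'" "K' \<in> K" for C D K'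
  proof (rule G.d_union)
    show "{x, y} \<notin> E" if "x \<in> C" "y \<in> D" for x y
      using component_no_edge[of K' U E x y] that \<open>C \<subseteq> K'\<close> \<open>D \<subseteq> U - K'\<close> \<open>K' \<in> K\<close> by (auto simp: K_def)
  qed (use that finU KU in \<open>auto dest: finite_subset\<close>)
  have split_del: "G.d (U - X) = G.d (C - X) + G.d (U - C - X)" if "C \<in> K" for C X
  proof -
    have "U - X = (C - X) \<union> (U - C - X)" using KU[OF that] by auto
    then show ?thesis using split[OF _ _ that, of "C - X" "U - C - X"] by auto
  qed
  \<comment> \<open>Deleting \<open>x\<close> changes the multiplicity of \<open>V\<close> exactly
    as it changes that of its component; written additively to avoid truncated subtraction.\<close>
  have dC: "G.d (V - {x}) + G.d C = G.d V + G.d (C - {x})" if "C \<in> K" "x \<in> C" for C x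
  proof -
    have "U - C - {x} = U - C" "x \<in> U" using that KU by auto
    then show ?thesis
      using split_del[OF that(1), of "{x}"] split_del[OF that(1), of "{}"] dU dUx[of x] that by simp
  qed
  \<comment> \<open>A nonessential neighbour of an essential vertex is special, hence outside
    \<open>U\<close>; so essentiality spreads along paths in \<open>U\<close>.\<close>
  have ess_prop: "y \<in> ?B" if "x \<in> ?B" "C \<in> K" "x \<in> C" "y \<in> C" for x y C
  proof -
    have "(x, y) \<in> (adj_rel U (induced_edges E U))\<^sup>*"
      using component_eq[of C U _ x] that by (auto simp: K_def)
    then show ?thesis
    proof (induction rule: rtrancl_induct)
      case (step y z)
      then have "y \<in> U" "z \<in> U" "{z, y} \<in> E" by (auto simp: adj_rel_induced insert_commute)
      then have "z \<in> V" "z \<notin> ?A" by (auto simp: U_def)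
      then show ?case using step.IH \<open>{z, y} \<in> E\<close> unfolding A B by auto
    qed (use that in simp)
  qed
  \<comment> \<open>A component of positive multiplicity has an essential vertex, hence only such
    vertices, and Gallai's lemma gives multiplicity one.\<close>
  have dichotomy: "(C \<subseteq> ?B \<and> G.d C = 1 \<and> C \<in> Hcomps \<theta> V E) \<or> (C \<inter> ?B = {} \<and> G.d C = 0)" if C: "C \<in> K" for C
  proof (cases "C \<inter> ?B = {}")
    case True
    have "G.d C = 0"
    proof (rule ccontr)
      assume "G.d C \<noteq> 0"
      then obtain x where "x \<in> C" "G.d (C - {x}) + 1 = G.d C"
        using G.essential_exists[of C] KU[OF C] finU by (auto dest: finite_subset)
      then have "x \<in> ?B" using dC[OF C, of x] KU[OF C] by (auto simp: B U_def)
      then show False using True \<open>x \<in> C\<close> by auto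
    qed
    then show ?thesis using True by simp
  next
    case False
    then have sub: "C \<subseteq> ?B" using ess_prop C by blast
    have crit: "G.d (C - {x}) + 1 = G.d C" if "x \<in> C" for x
    proof -
      have "G.d (V - {x}) + 1 = G.d V" using that sub B by blast
      then show ?thesis using dC[OF C that] by simp
    qed
    have "G.d C = 1"
    proof (rule G.gallai)
      show "finite C" using KU[OF C] finU by (rule finite_subset)
      show "connected_graph C (induced_edges E C)"
        using C unfolding K_def by (rule component_connected)
    qed (rule crit)
    then show ?thesis using sub crit C by (auto simp: H)
  qed
  have BPN: "x \<in> ?B \<Longrightarrow> x \<notin> ?P" for x
    by (auto simp: Bset_def Pset_def positive_def ess del mG)

  \<comment> \<open>Case distinction on the positions of \<open>u\<close> and
    \<open>v\<close>\<close>
  show ?thesis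
  proof (cases "u \<in> ?A \<or> v \<in> ?A")
    case True
    \<comment> \<open>Removing \<open>x\<close> lowers only the count of special vertices, by one;
      the deletion of \<open>y\<close> must match this drop.\<close>
    have one: "G.d (U - {x, y}) = G.d V + card (?A - {x, y}) \<longleftrightarrow> y \<in> ?B"
      if "x \<in> ?A" "y \<notin> ?A" "y \<in> V" for x y
    proof -
      have eq: "U - {x, y} = U - {y}" "?A - {x, y} = ?A - {x}" using that by (auto simp: U_def)
      have "y \<in> U" using that by (simp add: U_def)
      then have "G.d (U - {y}) = G.d (V - {y}) + card ?A" by (rule dUx)
      moreover have "card ?A > 0" using that finA by (auto simp: card_gt_0_iff)
      moreover have "card (?A - {x}) = card ?A - 1" using that finA by simp
      ultimately show ?thesis unfolding eq B using that(3) by linarith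
    qed
    have two: "\<not> ?L" if "u \<in> ?A" "v \<in> ?A"
    proof -
      have "U - {u, v} = U" using that by (auto simp: U_def)
      moreover have "card (?A - {u, v}) < card ?A" using that finA by (intro psubset_card_mono) auto
      ultimately show ?thesis using dU unfolding L by simp
    qed
    have "?L \<longleftrightarrow> ?a"
      using True two one[of u v] one[of v u, unfolded insert_commute[of v u "{}"]] uV vV PA BA
      unfolding L by blast
    moreover have "\<not> (?b \<or> ?c \<or> ?d)" using True QHA by blast
    ultimately show ?thesis by blast
  next
    case False
    then have uvU: "u \<in> U" "v \<in> U" using uV vV by (auto simp: U_def)
    then obtain C D where C: "C \<in> K" "u \<in> C" and D: "D \<in> K" "v \<in> D"
      using component_exists unfolding K_def by metis
    have uniq: "X = C" if "X \<in> Qcomps \<theta> V E \<or> X \<in> Hcomps \<theta> V E" "u \<in> X" for X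
      using component_unique that C Q H unfolding K_def by metis
    have uniq': "X = D" if "X \<in> Qcomps \<theta> V E \<or> X \<in> Hcomps \<theta> V E" "v \<in> X" for X
      using component_unique that D Q H unfolding K_def by metis
    have "?A - {u, v} = ?A" using False by auto
    then have L': "?L \<longleftrightarrow> G.d (U - {u, v}) = G.d U" unfolding L dU by simp
    show ?thesis
    proof (cases "C = D")
      case True
      have "U - C - {u, v} = U - C" using C D True by auto
      \<comment> \<open>Everything outside \<open>C\<close> cancels.\<close>
      then have L'': "?L \<longleftrightarrow> G.d (C - {u, v}) = G.d C"
        unfolding L' using split_del[OF C(1), of "{u, v}"] split_del[OF C(1), of "{}"] by simp
      have nb: "\<not> ?b" using uniq uniq' True by blast
      \<comment> \<open>Vertices of one component are all essential or all not, so (a) cannot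
        occur.\<close>
      have na: "\<not> ?a" using dichotomy[OF C(1)] C D True BPN False by blast
      have vC: "v \<in> C" using D(2) True by simp
      have in_C: "(\<exists>X\<in>F. u \<in> X \<and> v \<in> X \<and> R X) \<longleftrightarrow> C \<in> F \<and> R C"
        if "\<And>X. X \<in> F \<Longrightarrow> u \<in> X \<Longrightarrow> X = C" for F R
        using that C(2) vC by metis
      have ceq: "?c \<longleftrightarrow> C \<in> Hcomps \<theta> V E \<and> G.d (C - {u, v}) = 1"
        unfolding delC by (rule in_C) (simp add: uniq)
      have deq: "?d \<longleftrightarrow> C \<in> Qcomps \<theta> V E \<and> G.d (C - {u, v}) = 0"
        unfolding delC by (rule in_C) (simp add: uniq)
      have "C \<in> Qcomps \<theta> V E \<longleftrightarrow> G.d C = 0"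
        using C by (simp add: Q)
      moreover have "C \<notin> Hcomps \<theta> V E" if "G.d C = 0" using that C by (auto simp: H)
      ultimately have "G.d (C - {u, v}) = G.d C \<longleftrightarrow> (C \<in> Hcomps \<theta> V E \<and> G.d (C - {u, v}) = 1) \<or>
          (C \<in> Qcomps \<theta> V E \<and> G.d (C - {u, v}) = 0)"
        using dichotomy[OF C(1)] by auto
      then show ?thesis by (simp only: L'' na nb ceq deq simp_thms)
    next
      case False
      then have disj: "C \<inter> D = {}" using component_unique C(1) D(1) unfolding K_def by (metis disjoint_iff)
      have "U - {u, v} = (C - {u}) \<union> ((D - {v}) \<union> (U - C - D))" "U = C \<union> (D \<union> (U - C - D))"
        using disj C(2) D(2) KU[OF C(1)] KU[OF D(1)] by auto
      moreover have "G.d ((C - {u}) \<union> ((D - {v}) \<union> (U - C - D))) = G.d (C - {u}) + G.d ((D - {v}) \<union> (U - C - D))"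
        "G.d (C \<union> (D \<union> (U - C - D))) = G.d C + G.d (D \<union> (U - C - D))"
        by (rule split[OF _ _ C(1)]; use disj KU[OF D(1)] in auto)+
      moreover have "G.d ((D - {v}) \<union> (U - C - D)) = G.d (D - {v}) + G.d (U - C - D)"
        "G.d (D \<union> (U - C - D)) = G.d D + G.d (U - C - D)"
        by (rule split[OF _ _ D(1)]; auto)+
      ultimately have "?L \<longleftrightarrow> G.d (C - {u}) + G.d (D - {v}) = G.d C + G.d D"
        unfolding L' by simp
      \<comment> \<open>The changes caused by \<open>u\<close> and \<open>v\<close> must cancel.
        Each is \<open>-1\<close>, \<open>0\<close> or \<open>1\<close>, so one vertex is positive
        and the other essential, or both are neutral.\<close>
      then have L'': "?L \<longleftrightarrow> G.d (V - {u}) + G.d (V - {v}) = 2 * G.d V"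
        using dC[OF C] dC[OF D] by auto
      have i: "G.d V \<le> G.d (V - {x}) + 1" "G.d (V - {x}) \<le> G.d V + 1" if "x \<in> V" for x
        using G.d_le_Suc_d_del G.d_del_le_Suc_d fin that by auto
      have cd: "\<not> ?c" "\<not> ?d" using uniq uniq' False by blast+
      have aeq: "?a \<longleftrightarrow> (u \<in> ?P \<and> v \<in> ?B) \<or> (v \<in> ?P \<and> u \<in> ?B)"
        using \<open>\<not> (u \<in> ?A \<or> v \<in> ?A)\<close> by blast
      have beq: "?b \<longleftrightarrow> u \<in> ?N \<and> v \<in> ?N"
      proof
        assume n: "u \<in> ?N \<and> v \<in> ?N"
        then have "u \<notin> ?B" "v \<notin> ?B" using N uvU by (auto simp: B)
        then have "C \<in> Qcomps \<theta> V E" "D \<in> Qcomps \<theta> V E"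
          using dichotomy[OF C(1)] dichotomy[OF D(1)] C D by (auto simp: Q)
        then show ?b using n C D False by blast
      qed blast
      have "G.d (V - {u}) + G.d (V - {v}) = 2 * G.d V \<longleftrightarrow>
          ((u \<in> ?P \<and> v \<in> ?B) \<or> (v \<in> ?P \<and> u \<in> ?B)) \<or> (u \<in> ?N \<and> v \<in> ?N)"
        unfolding P[OF uvU(1)] P[OF uvU(2)] N[OF uvU(1)] N[OF uvU(2)] B
        using i[OF uV] i[OF vV] uV vV by auto
      then show ?thesis by (simp only: L'' aeq beq cd simp_thms)
    qed
  qed
qed

end
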